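(* Let $m\ge2$, let $H$ be a complex Hilbert space, let $E$ be a POVM on $\Omega_m=\{0,\dots,m-1\}^{\mathbb N}$ with values in $B(H)$, and let $c>0$. Consider the one-to-one correspondence between measures $F\in\mathcal M_+(\Omega_m,H)$ with $F\le cE$ and positive range martingales $\{X_w\}$ for $E$ with $0\le X_w\le cI_{H_w}$ for every finite word $w$, characterized by $F([w])=E_w^{1/2}X_wE_w^{1/2}$ for every finite word $w$. Under this correspondence, $$X_\varnothing=F(\Omega_m).$$ In particular, the measures $F\in\mathcal M_+(\Omega_m,H)$ satisfying $F\le cE$ and having fixed total mass $F(\Omega_m)=A\in B(H)_+$ are in one-to-one correspondence with the positive range martingales satisfying $0\le X_w\le cI_{H_w}$ for every $w$ and $X_\varnothing=A$.
   Context: $\Omega_m$ carries its product Borel $\sigma$-algebra $\mathcal B(\Omega_m)$. For a finite word $w=w_1\cdots w_n$ in $\{0,\dots,m-1\}$, $[w]=\{x\in\Omega_m:x_1=w_1,\dots,x_n=w_n\}$; the empty word is $\varnothing$, and $[\varnothing]=\Omega_m$; $wj$ is $w$ with the letter $j$ appended. $\mathcal M_+(\Omega_m,H)$ is the cone of finite positive operator-valued measures, i.e. maps $F:\mathcal B(\Omega_m)\to B(H)_+$ countably additive in the weak operator topology (not assumed normalized). A POVM is such a map $E$ with $E(\Omega_m)=I$. $F\le cE$ means $0\le F(B)\le cE(B)$ for every Borel set $B\subseteq\Omega_m$. Put $E_w=E([w])$ and $H_w=\overline{\operatorname{ran}}(E_w^{1/2})$; operators on $H_w$ are extended by zero on $H_w^\perp$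 in products with $E_w^{1/2}$. For $0\le j\le m-1$, the edge contraction $C_{wj}:H_w\to H_{wj}$ is the unique contraction with $C_{wj}E_w^{1/2}h=E_{wj}^{1/2}h$ for all $h\in H$. A bounded range martingale for $E$ is a family of self-adjoint operators $X_w\in B(H_w)$, indexed by all finite words $w$, such that $\sup_w\|X_w\|<\infty$ and $X_w=\sum_{j=0}^{m-1}C_{wj}^*X_{wj}C_{wj}$ for every $w$. A positive range martingale is a bounded range martingale with $X_w\ge0$ for every $w$. *)

theory Defs
  imports "HOL-Analysis.Analysis"
begin

text \<open>
  The inner product \<open>cinner\<close> is linear in the second argument. The underlying real vector space
  carries the real inner product \<open>Re (cinner x y)\<close>; so the norm inherited from
  \<open>real_inner\<close> is the Hilbert space norm.
\<close>

class chilbert_space = real_inner + complete_space +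
  fixes scaleC :: "complex \<Rightarrow> 'a \<Rightarrow> 'a" (infixr "*\<^sub>C" 75)
    and cinner :: "'a \<Rightarrow> 'a \<Rightarrow> complex"
  assumes scaleC_add_right: "a *\<^sub>C (x + y) = a *\<^sub>C x + a *\<^sub>C y"
    and scaleC_add_left: "(a + b) *\<^sub>C x = a *\<^sub>C x + b *\<^sub>C x"
    and scaleC_scaleC: "a *\<^sub>C (b *\<^sub>C x) = (a * b) *\<^sub>C x"
    and scaleC_of_real: "complex_of_real r *\<^sub>C x = r *\<^sub>R x"
    and cinner_commute: "cinner x y = cnj (cinner y x)"
    and cinner_add_right: "cinner x (y + z) = cinner x y + cinner x z"
    and cinner_scaleC_right: "cinner x (a *\<^sub>C y) = a * cinner x y"
    and inner_eq_Re_cinner: "inner x y = Re (cinner x y)"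

instantiation complex :: chilbert_space
begin

definition scaleC_complex :: "complex \<Rightarrow> complex \<Rightarrow> complex" where
  "scaleC_complex a x = a * x"

definition cinner_complex :: "complex \<Rightarrow> complex \<Rightarrow> complex" where
  "cinner_complex x y = cnj x * y"

instance
  by standard
    (auto simp: scaleC_complex_def cinner_complex_def inner_complex_def algebra_simps scaleR_conv_of_real)

end

text \<open>\<open>B(H)\<close>: the type \<open>'a \<Rightarrow>\<^sub>L 'a\<close> consists of all bounded real-linear maps.\<close>

definition bounded_ops :: "('a::chilbert_space \<Rightarrow>\<^sub>L 'a) set" where
  "bounded_ops = {T :: 'a \<Rightarrow>\<^sub>L 'a. \<forall>a x. T (a *\<^sub>C x) = a *\<^sub>C T x}"

definition cadjoint :: "('a::chilbert_space \<Rightarrow>\<^sub>L 'a) \<Rightarrow> ('a \<Rightarrow>\<^sub>L 'a)" where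
  "cadjoint T = (THE S :: 'a \<Rightarrow>\<^sub>L 'a. S \<in> bounded_ops \<and> (\<forall>x y. cinner (T x) y = cinner x (S y)))"

definition op_le_on :: "'a::chilbert_space set \<Rightarrow> ('a \<Rightarrow>\<^sub>L 'a) \<Rightarrow> ('a \<Rightarrow>\<^sub>L 'a) \<Rightarrow> bool" where
  "op_le_on V S T \<longleftrightarrow> (\<forall>x\<in>V. cinner x ((T - S) x) \<in> \<real>\<^sub>\<ge>\<^sub>0)"

definition positive_ops :: "('a::chilbert_space \<Rightarrow>\<^sub>L 'a) set" where
  "positive_ops = {T \<in> bounded_ops. op_le_on UNIV 0 T}"

definition op_sqrt :: "('a::chilbert_space \<Rightarrow>\<^sub>L 'a) \<Rightarrow> ('a \<Rightarrow>\<^sub>L 'a)" where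
  "op_sqrt T = (THE R. R \<in> positive_ops \<and> R o\<^sub>L R = T)"

definition orth_compl :: "'a::chilbert_space set \<Rightarrow> 'a set" where
  "orth_compl V = {x. \<forall>v\<in>V. cinner v x = 0}"

text \<open>
  For closed subspaces \<open>V\<close>, \<open>W\<close>, a bounded operator from \<open>V\<close> to \<open>W\<close> is represented by its
  extension to the whole space by zero on the orthogonal complement of \<open>V\<close>. This representation
  respects sums, products, norms and adjoints.
\<close>

definition ops_between :: "'a::chilbert_space set \<Rightarrow> 'a set \<Rightarrow> ('a \<Rightarrow>\<^sub>L 'a) set" where
  "ops_between V W =
     {T :: 'a \<Rightarrow>\<^sub>L 'a. T \<in> bounded_ops \<and> (\<forall>x. T x \<in> W) \<and> (\<forall>x \<in> orth_compl V. T x = 0)}"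

text \<open>The coordinates \<open>x\<^sub>1, x\<^sub>2, \<dots>\<close> of a sequence are \<open>x 0, x 1, \<dots>\<close> here.\<close>

definition Omega :: "nat \<Rightarrow> (nat \<Rightarrow> nat) measure" where
  "Omega m = PiM UNIV (\<lambda>_. count_space {..<m})"

abbreviation words :: "nat \<Rightarrow> nat list set" where
  "words m \<equiv> lists {..<m}"

definition cyl :: "nat \<Rightarrow> nat list \<Rightarrow> (nat \<Rightarrow> nat) set" where
  "cyl m w = {x \<in> space (Omega m). \<forall>i < length w. x i = w ! i}"

type_synonym 'a op_measure = "(nat \<Rightarrow> nat) set \<Rightarrow> ('a \<Rightarrow>\<^sub>L 'a)"

text \<open>
  The extensional function space \<open>\<rightarrow>\<^sub>E\<close> makes a measure determined by its values on
  the measurable sets.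
\<close>

definition pos_op_measures :: "nat \<Rightarrow> 'a::chilbert_space op_measure set" where
  "pos_op_measures m =
     {F \<in> sets (Omega m) \<rightarrow>\<^sub>E positive_ops.
        \<forall>B :: nat \<Rightarrow> (nat \<Rightarrow> nat) set. range B \<subseteq> sets (Omega m) \<longrightarrow> disjoint_family B \<longrightarrow>
          (\<forall>x y. (\<lambda>i. cinner x (F (B i) y)) sums cinner x (F (\<Union>i. B i) y))}"

definition povm :: "nat \<Rightarrow> 'a::chilbert_space op_measure \<Rightarrow> bool" where
  "povm m E \<longleftrightarrow> E \<in> pos_op_measures m \<and> E (space (Omega m)) = id_blinfun"

definition dominated_measures ::
    "nat \<Rightarrow> real \<Rightarrow> 'a::chilbert_space op_measure \<Rightarrow> 'a op_measure set" where
  "dominated_measures m c E =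
     {F \<in> pos_op_measures m. \<forall>B \<in> sets (Omega m).
        op_le_on UNIV 0 (F B) \<and> op_le_on UNIV (F B) (c *\<^sub>R E B)}"

definition sqrt_at :: "nat \<Rightarrow> 'a::chilbert_space op_measure \<Rightarrow> nat list \<Rightarrow> ('a \<Rightarrow>\<^sub>L 'a)" where
  "sqrt_at m E w = op_sqrt (E (cyl m w))"

definition range_space :: "nat \<Rightarrow> 'a::chilbert_space op_measure \<Rightarrow> nat list \<Rightarrow> 'a set" where
  "range_space m E w = closure (range (sqrt_at m E w))"

definition edge_contraction ::
    "nat \<Rightarrow> 'a::chilbert_space op_measure \<Rightarrow> nat list \<Rightarrow> nat \<Rightarrow> ('a \<Rightarrow>\<^sub>L 'a)" where
  "edge_contraction m E w j =
     (THE C :: 'a \<Rightarrow>\<^sub>L 'a. C \<in> ops_between (range_space m E w) (range_space m E (w @ [j])) \<and> norm C \<le> 1 \<and>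
        (\<forall>h. C (sqrt_at m E w h) = sqrt_at m E (w @ [j]) h))"

type_synonym 'a op_family = "nat list \<Rightarrow> ('a \<Rightarrow>\<^sub>L 'a)"

definition bounded_range_martingales ::
    "nat \<Rightarrow> 'a::chilbert_space op_measure \<Rightarrow> 'a op_family set" where
  "bounded_range_martingales m E =
     {X \<in> (\<Pi>\<^sub>E w\<in>words m. ops_between (range_space m E w) (range_space m E w)).
        (\<forall>w\<in>words m. cadjoint (X w) = X w) \<and>
        bdd_above ((\<lambda>w. norm (X w)) ` words m) \<and>
        (\<forall>w\<in>words m. X w =
           (\<Sum>j<m. cadjoint (edge_contraction m E w j) o\<^sub>L X (w @ [j]) o\<^sub>L edge_contraction m E w j))}"

definition positive_range_martingales ::
    "nat \<Rightarrow> 'a::chilbert_space op_measure \<Rightarrow> 'a op_family set" where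
  "positive_range_martingales m E =
     {X \<in> bounded_range_martingales m E. \<forall>w\<in>words m. op_le_on (range_space m E w) 0 (X w)}"

definition dominated_martingales ::
    "nat \<Rightarrow> real \<Rightarrow> 'a::chilbert_space op_measure \<Rightarrow> 'a op_family set" where
  "dominated_martingales m c E =
     {X \<in> positive_range_martingales m E. \<forall>w\<in>words m.
        op_le_on (range_space m E w) 0 (X w) \<and>
        op_le_on (range_space m E w) (X w) (c *\<^sub>R id_blinfun)}"

end

theory Submission
  imports Defs
begin

text \<open>
  Both directions of the correspondence reduce to statements about one word and about one vector.

  From measures to martingales. Put \<open>R = E\<^sub>w\<^bsup>1/2\<^esup>\<close>. If \<open>0 \<le> F([w]) \<le> c R\<^sup>2\<close>, then
  \<open>\<parallel>F([w])\<^bsup>1/2\<^esup> h\<parallel> \<le> c\<^bsup>1/2\<^esup> \<parallel>R h\<parallel>\<close>, so that Douglas' factorization yields \<open>F([w])\<^bsup>1/2\<^esup> = C R\<close>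
  with \<open>\<parallel>C\<parallel>\<^sup>2 \<le> c\<close>, and \<open>X\<^sub>w = C\<^sup>* C\<close> satisfies \<open>F([w]) = R X\<^sub>w R\<close> and \<open>0 \<le> X\<^sub>w \<le> c\<close>
  (\<open>compression_exists\<close>). An operator on the closed range of \<open>R\<close> is determined by its compression
  \<open>R X R\<close> (\<open>compression_inj\<close>). Compressing the martingale identity by \<open>R\<close> gives
  \<open>F([w]) = \<Sum>\<^sub>j F([wj])\<close> (\<open>compression_martingale_sum\<close>), so the identity is equivalent to the additivity
  of \<open>F\<close> on cylinders.

  From martingales to measures. The operators \<open>T\<^sub>w = E\<^sub>w\<^bsup>1/2\<^esup> X\<^sub>w E\<^sub>w\<^bsup>1/2\<^esup>\<close> are positive, consistent,
  and dominated by \<open>c E\<^sub>w\<close>. For each vector \<open>x\<close> the weights \<open>\<langle>x, T\<^sub>w x\<rangle>\<close> define an additive set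
  function on the algebra of sets that depend on finitely many coordinates. It is dominated by the
  measure \<open>c \<langle>x, E(B) x\<rangle>\<close>, hence continuous at the empty set, and Caratheodory's theorem extends it
  (\<open>sigma_additive_extension\<close>). Polarization in \<open>x\<close> produces the operators \<open>F(B)\<close>; bilinearity,
  symmetry and complex linearity hold on cylinders and hence for all measurable sets
  (\<open>sigma_additive_eqI\<close>, \<open>dominated_measure_extension\<close>).

  Since \<open>E\<close> has total mass \<open>1\<close>, the compression for the empty word is trivial, and \<open>X\<close> at the empty
  word is the total mass of \<open>F\<close>. Everything is carried out with the real inner product
  \<open>Re \<langle>x, y\<rangle>\<close>: a bounded real-linear map is complex-linear iff it commutes with \<open>\<i>\<close>, and for
  complex-linear maps symmetry and adjoints are the same for both inner products. Projections, the
  representation of bilinear forms, and square roots of positive operators are constructed for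
  real Hilbert spaces.
\<close>

instance chilbert_space \<subseteq> banach ..

section \<open>Real Hilbert spaces\<close>

text \<open>The first-order condition at a minimum.\<close>

lemma linear_coeff_eq_0_if_quadratic_nonneg:
  fixes a b :: real
  assumes "\<And>t. 0 \<le> 2 * t * a + t\<^sup>2 * b"
  shows "a = 0"
proof (rule ccontr)
  assume "a \<noteq> 0"
  define B where "B = \<bar>b\<bar> + 1"
  have B: "B > 0" "b < 2 * B" by (auto simp: B_def)
  have "0 \<le> (2 * (- a / B) * a + (- a / B)\<^sup>2 * b) * B\<^sup>2"
    using assms[of "- a / B"] by (intro mult_nonneg_nonneg) auto
  also have "\<dots> = a\<^sup>2 * (b - 2 * B)"
    using B by (simp add: field_simps power2_eq_square)
  also have "\<dots> < 0" using B \<open>a \<noteq> 0\<close> by (intro mult_pos_neg) auto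
  finally show False by simp
qed

lemma parallelogram:
  fixes x y :: "'a::real_inner"
  shows "(norm (x + y))\<^sup>2 + (norm (x - y))\<^sup>2 = 2 * (norm x)\<^sup>2 + 2 * (norm y)\<^sup>2"
  by (simp add: power2_norm_eq_inner algebra_simps)

lemma orthogonal_projection_exists:
  fixes V :: "'a::{real_inner,banach} set"
  assumes "closed V" "subspace V"
  obtains v where "v \<in> V" "\<And>u. u \<in> V \<Longrightarrow> inner (x - v) u = 0"
proof -
  define D where "D = (\<lambda>v. (norm (x - v))\<^sup>2) ` V"
  define d where "d = Inf D"
  have 0: "0 \<in> V" using assms(2) by (rule subspace_0)
  have bdd: "bdd_below D" by (auto simp: D_def intro: bdd_belowI[of _ 0])
  have ne: "D \<noteq> {}" using 0 by (auto simp: D_def)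
  have dle: "d \<le> (norm (x - v))\<^sup>2" if "v \<in> V" for v
    unfolding d_def using that bdd by (auto simp: D_def intro: cInf_lower)
  have "\<exists>v\<in>V. (norm (x - v))\<^sup>2 < d + 1 / real (Suc n)" for n
  proof -
    have "Inf D < d + 1 / real (Suc n)" by (simp add: d_def)
    then show ?thesis using cInf_less_iff[OF ne bdd] by (auto simp: D_def)
  qed
  then obtain v where v: "\<And>n. v n \<in> V" "\<And>n. (norm (x - v n))\<^sup>2 < d + 1 / real (Suc n)"
    by metis
  have close: "(norm (v k - v n))\<^sup>2 \<le> 4 / real (Suc N)" if "N \<le> k" "N \<le> n" for k n N
  proof -
    \<comment> \<open>parallelogram law for \<open>x - v k\<close> and \<open>x - v n\<close>: half of their sum is the difference of \<open>x\<close>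
      and a vector of \<open>V\<close>, hence has norm at least \<open>sqrt d\<close>\<close>
    have "(1/2) *\<^sub>R (v k + v n) \<in> V"
      using v assms(2) by (intro subspace_mul subspace_add) auto
    then have "d \<le> (norm (x - (1/2) *\<^sub>R (v k + v n)))\<^sup>2" by (rule dle)
    also have "x - (1/2) *\<^sub>R (v k + v n) = (1/2) *\<^sub>R ((x - v k) + (x - v n))"
      by (simp add: algebra_simps flip: scaleR_add_left)
    also have "(norm \<dots>)\<^sup>2 = (norm ((x - v k) + (x - v n)))\<^sup>2 / 4"
      by (simp add: power2_eq_square)
    finally have "4 * d \<le> (norm ((x - v k) + (x - v n)))\<^sup>2" by simp
    moreover have "(norm ((x - v k) + (x - v n)))\<^sup>2 + (norm ((x - v k) - (x - v n)))\<^sup>2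
        = 2 * (norm (x - v k))\<^sup>2 + 2 * (norm (x - v n))\<^sup>2"
      by (rule parallelogram)
    moreover have "norm ((x - v k) - (x - v n)) = norm (v k - v n)"
      by (simp add: norm_minus_commute)
    moreover have "1 / real (Suc k) \<le> 1 / real (Suc N)" "1 / real (Suc n) \<le> 1 / real (Suc N)"
      using that by (auto intro!: divide_left_mono)
    ultimately show ?thesis using v(2)[of k] v(2)[of n] by simp
  qed
  have "Cauchy v"
  proof (rule CauchyI)
    fix e :: real assume "e > 0"
    obtain N :: nat where N: "4 / e\<^sup>2 < real N" using reals_Archimedean2 by blast
    show "\<exists>M. \<forall>k\<ge>M. \<forall>n\<ge>M. norm (v k - v n) < e"
    proof (intro exI[of _ N] allI impI)
      fix k n assume kn: "N \<le> k" "N \<le> n"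
      have "(norm (v k - v n))\<^sup>2 \<le> 4 / real (Suc N)" by (rule close[OF kn])
      also have "\<dots> < e\<^sup>2" using N \<open>e > 0\<close> by (simp add: field_simps add_strict_increasing)
      finally show "norm (v k - v n) < e" using \<open>e > 0\<close> by (simp add: power_less_imp_less_base)
    qed
  qed
  then obtain w where w: "v \<longlonglongrightarrow> w" using Cauchy_convergent convergent_def by blast
  have wV: "w \<in> V" using assms(1) v(1) w closed_sequentially by blast
  have "(\<lambda>n. (norm (x - v n))\<^sup>2) \<longlonglongrightarrow> (norm (x - w))\<^sup>2" by (intro tendsto_intros w)
  moreover have "(\<lambda>n. d + 1 / real (Suc n)) \<longlonglongrightarrow> d + 0"
    by (intro tendsto_intros LIMSEQ_Suc[OF lim_1_over_n])
  ultimately have wd: "(norm (x - w))\<^sup>2 \<le> d"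
    using v(2) by (intro LIMSEQ_le[of _ _ "\<lambda>n. d + 1 / real (Suc n)"]) (auto intro: less_imp_le)
  have "inner (x - w) u = 0" if "u \<in> V" for u
  proof -
    have "- inner (x - w) u = 0"
    proof (rule linear_coeff_eq_0_if_quadratic_nonneg)
      fix t :: real
      have "w + t *\<^sub>R u \<in> V" using wV that assms(2) by (intro subspace_add subspace_mul)
      then have "(norm (x - w))\<^sup>2 \<le> (norm (x - (w + t *\<^sub>R u)))\<^sup>2" by (rule order_trans[OF wd dle])
      moreover have "(norm (x - (w + t *\<^sub>R u)))\<^sup>2
          = (norm (x - w))\<^sup>2 - 2 * t * inner (x - w) u + t\<^sup>2 * inner u u"
        unfolding power2_norm_eq_inner by (simp add: algebra_simps inner_commute power2_eq_square)
      ultimately show "0 \<le> 2 * t * (- inner (x - w) u) + t\<^sup>2 * inner u u" by simp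
    qed
    then show ?thesis by simp
  qed
  with wV show ?thesis using that by blast
qed

lemma riesz_representation:
  fixes f :: "'a::{real_inner,banach} \<Rightarrow> real"
  assumes "bounded_linear f"
  obtains z where "\<And>x. f x = inner x z"
proof -
  interpret bounded_linear f by fact
  define V where "V = {x. f x = 0}"
  have "closed V" unfolding V_def
    by (intro closed_Collect_eq continuous_on continuous_on_const)
       (use linear_continuous_on assms in auto)
  moreover have "subspace V" by (auto simp: V_def subspace_def add scaleR zero)
  ultimately have proj: "\<exists>v\<in>V. \<forall>u\<in>V. inner (y - v) u = 0" for y
    using orthogonal_projection_exists by metis
  show ?thesis
  proof (cases "\<exists>y. f y \<noteq> 0")
    case False
    then show ?thesis using that[of 0] by auto
  next
    case True
    then obtain y where y: "f y \<noteq> 0" by blast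
    obtain v where v: "f v = 0" "\<And>u. f u = 0 \<Longrightarrow> inner (y - v) u = 0"
      using proj[of y] by (auto simp: V_def)
    \<comment> \<open>\<open>u\<close> is orthogonal to the kernel of \<open>f\<close>\<close>
    define u where "u = y - v"
    have fu: "f u \<noteq> 0" using y v by (simp add: u_def diff)
    then have u0: "inner u u \<noteq> 0" using zero by auto
    have "f x = inner x ((f u / inner u u) *\<^sub>R u)" for x
    proof -
      have "f (x - (f x / f u) *\<^sub>R u) = 0" using fu by (simp add: diff scaleR)
      then have "inner u (x - (f x / f u) *\<^sub>R u) = 0" using v(2) unfolding u_def by blast
      then show ?thesis using fu u0 by (simp add: inner_diff_right inner_commute field_simps)
    qed
    then show ?thesis using that by blast
  qed
qed

lemma bounded_bilinear_representation:
  fixes b :: "'a::{real_inner,banach} \<Rightarrow> 'b::real_normed_vector \<Rightarrow> real"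
  assumes "bounded_bilinear b"
  obtains S :: "'b \<Rightarrow>\<^sub>L 'a" where "\<And>x y. b x y = inner x (S y)"
proof -
  interpret bounded_bilinear b by fact
  have "\<exists>z. \<forall>x. b x y = inner x z" for y
    using riesz_representation[OF bounded_linear_left[of y]] by metis
  then obtain s where s: "\<And>x y. b x y = inner x (s y)" by metis
  have eqI: "z = z'" if "\<And>x. inner x z = inner x z'" for z z' :: 'a
  proof -
    have "inner (z - z') (z - z') = 0" using that[of "z - z'"] by (simp add: inner_diff_right)
    then show ?thesis by simp
  qed
  obtain K where K0: "0 \<le> K" and K: "\<And>x y. norm (b x y) \<le> norm x * norm y * K"
    using nonneg_bounded by blast
  have "bounded_linear s"
  proof (rule bounded_linear_intro[of _ K])
    show "s (x + y) = s x + s y" for x y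
      by (rule eqI) (simp add: inner_add_right add_right flip: s)
    show "s (r *\<^sub>R x) = r *\<^sub>R s x" for r x
      by (rule eqI) (simp add: scaleR_right flip: s)
    show "norm (s x) \<le> norm x * K" for x
    proof (cases "s x = 0")
      case True
      then show ?thesis using K0 by simp
    next
      case False
      have "norm (s x) * norm (s x) = norm (b (s x) x)"
        by (simp add: s flip: power2_eq_square power2_norm_eq_inner)
      also have "\<dots> \<le> norm (s x) * (norm x * K)" using K[of "s x" x] by (simp add: mult_ac)
      finally show ?thesis using False by simp
    qed
  qed
  then have "b x y = inner x (Blinfun s y)" for x y by (simp add: s bounded_linear_Blinfun_apply)
  then show ?thesis using that by blast
qed

lemma blinfun_adjoint_exists:
  fixes T :: "'a::{real_inner,banach} \<Rightarrow>\<^sub>L 'b::real_inner"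
  shows "\<exists>S :: 'b \<Rightarrow>\<^sub>L 'a. \<forall>x y. inner (T x) y = inner x (S y)"
proof -
  have "bounded_bilinear (\<lambda>x y. inner (T x) y)"
    using bounded_bilinear.comp1[OF bounded_bilinear_inner blinfun.bounded_linear_right] .
  from bounded_bilinear_representation[OF this]
  obtain S :: "'b \<Rightarrow>\<^sub>L 'a" where "\<And>x y. inner (T x) y = inner x (S y)" by blast
  then show ?thesis by blast
qed

section \<open>Positive operators and their square roots\<close>

text \<open>Symmetry and positivity with respect to the real inner product. For complex-linear
  operators these are the usual notions, see \<open>positive_ops_iff\<close> below.\<close>

definition symmetric_op :: "('a::real_inner \<Rightarrow>\<^sub>L 'a) \<Rightarrow> bool" where
  "symmetric_op T \<longleftrightarrow> (\<forall>x y. inner (T x) y = inner x (T y))"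

definition psd_op :: "('a::real_inner \<Rightarrow>\<^sub>L 'a) \<Rightarrow> bool" where
  "psd_op T \<longleftrightarrow> symmetric_op T \<and> (\<forall>x. 0 \<le> inner x (T x))"

lemma psd_op_apply_eq_0:
  assumes "psd_op T" "inner x (T x) = 0"
  shows "T x = 0"
proof -
  have "inner z (T x) = 0" for z
  proof (rule linear_coeff_eq_0_if_quadratic_nonneg)
    fix t :: real
    have "inner x (T z) = inner z (T x)"
      using assms by (metis psd_op_def symmetric_op_def inner_commute)
    moreover have "0 \<le> inner (x + t *\<^sub>R z) (T (x + t *\<^sub>R z))" using assms by (simp add: psd_op_def)
    ultimately show "0 \<le> 2 * t * inner z (T x) + t\<^sup>2 * inner z (T z)"
      using assms(2)
      by (simp add: blinfun.add_right blinfun.scaleR_right inner_add_left inner_add_right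
            power2_eq_square algebra_simps)
  qed
  from this[of "T x"] show ?thesis by simp
qed

lemma psd_op_cauchy_schwarz:
  assumes "psd_op T"
  shows "(inner x (T y))\<^sup>2 \<le> inner x (T x) * inner y (T y)"
proof (cases "inner y (T y) = 0")
  case True
  then have "T y = 0" by (rule psd_op_apply_eq_0[OF assms])
  then show ?thesis by simp
next
  case False
  then have pos: "inner y (T y) > 0" using assms by (metis psd_op_def order_le_less)
  have sym: "inner y (T x) = inner x (T y)"
    using assms by (metis psd_op_def symmetric_op_def inner_commute)
  define z where "z = inner y (T y) *\<^sub>R x - inner x (T y) *\<^sub>R y"
  have "0 \<le> inner z (T z)" using assms by (simp add: psd_op_def)
  also have "\<dots> = inner y (T y) * (inner x (T x) * inner y (T y) - (inner x (T y))\<^sup>2)"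
    by (simp add: z_def blinfun.diff_right blinfun.scaleR_right inner_diff_left inner_diff_right
          power2_eq_square algebra_simps sym)
  finally show ?thesis using pos by (simp add: zero_le_mult_iff)
qed

lemma norm_le_one_if_between_0_and_id:
  assumes "psd_op B" "\<And>x. inner x (B x) \<le> (norm x)\<^sup>2"
  shows "norm B \<le> 1"
proof (rule norm_blinfun_bound)
  fix x
  have "((norm (B x))\<^sup>2)\<^sup>2 = (inner (B x) (B x))\<^sup>2" by (simp add: power2_norm_eq_inner)
  also have "\<dots> \<le> inner (B x) (B (B x)) * inner x (B x)" by (rule psd_op_cauchy_schwarz) fact
  also have "\<dots> \<le> (norm (B x))\<^sup>2 * (norm x)\<^sup>2"
    using assms by (intro mult_mono) (auto simp: psd_op_def)
  finally have "(norm (B x))\<^sup>2 * (norm (B x))\<^sup>2 \<le> (norm (B x))\<^sup>2 * (norm x)\<^sup>2"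
    by (simp only: power2_eq_square)
  then have "(norm (B x))\<^sup>2 \<le> (norm x)\<^sup>2"
    by (metis mult_le_cancel_left_pos zero_less_power2 zero_le_power2 power2_eq_iff_nonneg order_le_less)
  then show "norm (B x) \<le> 1 * norm x" by (simp add: power2_le_iff_abs_le)
qed simp

text \<open>Square roots are unique among commuting operators: \<open>y = R x - S x\<close> satisfies \<open>(R + S) y = 0\<close>,
  and positivity forces \<open>R y = S y = 0\<close>.\<close>

lemma psd_op_sqrt_unique:
  assumes "psd_op R" "psd_op S" "R o\<^sub>L R = S o\<^sub>L S" "R o\<^sub>L S = S o\<^sub>L R"
  shows "R = S"
proof (rule blinfun_eqI)
  fix x
  have sq: "R (R v) = S (S v)" and com: "R (S v) = S (R v)" for v
    using assms(3,4) by (metis blinfun_apply_blinfun_compose)+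
  define y where "y = R x - S x"
  have "R y + S y = 0" by (simp add: y_def blinfun.diff_right sq com)
  then have "inner y (R y) + inner y (S y) = 0" by (metis inner_add_right inner_zero_right)
  moreover have "0 \<le> inner y (R y)" "0 \<le> inner y (S y)" using assms by (auto simp: psd_op_def)
  ultimately have "R y = 0" "S y = 0" using assms psd_op_apply_eq_0 by force+
  then have "inner (R x - S x) y = 0"
    using assms(1,2) by (simp add: inner_diff_left psd_op_def symmetric_op_def)
  then show "R x = S x" by (simp add: y_def)
qed

text \<open>For \<open>\<parallel>B\<parallel> \<le> 1\<close> the iteration \<open>X \<mapsto> (B + X\<^sup>2) / 2\<close> converges to a solution of
  \<open>(1 - X)\<^sup>2 = 1 - B\<close>.\<close>

fun sqrt_iter :: "('a::real_normed_vector \<Rightarrow>\<^sub>L 'a) \<Rightarrow> nat \<Rightarrow> ('a \<Rightarrow>\<^sub>L 'a)" where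
  "sqrt_iter B 0 = 0"
| "sqrt_iter B (Suc n) = (1/2) *\<^sub>R (B + (sqrt_iter B n o\<^sub>L sqrt_iter B n))"

text \<open>The same iteration for the scalar \<open>1\<close>, which majorizes the norms of the operators and of
  their increments.\<close>

fun sqrt_iter_bound :: "nat \<Rightarrow> real" where
  "sqrt_iter_bound 0 = 0"
| "sqrt_iter_bound (Suc n) = (1 + (sqrt_iter_bound n)\<^sup>2) / 2"

lemma sqrt_iter_bound_range: "0 \<le> sqrt_iter_bound n" "sqrt_iter_bound n \<le> 1"
proof (induction n)
  case (Suc n)
  {
    case 1 then show ?case by simp
  next
    case 2 then show ?case using Suc by (simp add: power_le_one)
  }
qed auto

lemma sqrt_iter_commute:
  assumes "S o\<^sub>L B = B o\<^sub>L S"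
  shows "S o\<^sub>L sqrt_iter B n = sqrt_iter B n o\<^sub>L S"
proof (induction n)
  case (Suc n)
  have B: "S (B x) = B (S x)" and X: "S (sqrt_iter B n x) = sqrt_iter B n (S x)" for x
    using assms Suc by (metis blinfun_apply_blinfun_compose)+
  show ?case
    by (rule blinfun_eqI) (simp add: B X blinfun.add_right blinfun.scaleR_right blinfun.add_left blinfun.scaleR_left)
qed (auto intro: blinfun_eqI)

lemma norm_sqrt_iter_le:
  assumes "norm B \<le> 1"
  shows "norm (sqrt_iter B n) \<le> sqrt_iter_bound n"
proof (induction n)
  case (Suc n)
  let ?X = "sqrt_iter B n"
  have "norm (?X o\<^sub>L ?X) \<le> (sqrt_iter_bound n)\<^sup>2"
    using norm_blinfun_compose[of ?X ?X] mult_mono[OF Suc Suc] sqrt_iter_bound_range[of n]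
    by (simp add: power2_eq_square)
  then have "norm (B + (?X o\<^sub>L ?X)) \<le> 1 + (sqrt_iter_bound n)\<^sup>2"
    using norm_triangle_ineq[of B "?X o\<^sub>L ?X"] assms by linarith
  then show ?case by simp
qed simp

lemma norm_sqrt_iter_diff_le:
  assumes "norm B \<le> 1"
  shows "norm (sqrt_iter B (Suc n) - sqrt_iter B n) \<le> sqrt_iter_bound (Suc n) - sqrt_iter_bound n"
proof (induction n)
  case 0
  then show ?case using assms by simp
next
  case (Suc n)
  let ?X = "sqrt_iter B n" and ?Y = "sqrt_iter B (Suc n)"
  let ?x = "sqrt_iter_bound n" and ?y = "sqrt_iter_bound (Suc n)"
  have "?X o\<^sub>L B = B o\<^sub>L ?X" using sqrt_iter_commute[of B B n] by simp
  then have "?X o\<^sub>L ?Y = ?Y o\<^sub>L ?X" by (rule sqrt_iter_commute)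
  then have com: "?X (?Y v) = ?Y (?X v)" for v by (metis blinfun_apply_blinfun_compose)
  have "sqrt_iter B (Suc (Suc n)) - ?Y = (1/2) *\<^sub>R ((?Y o\<^sub>L ?Y) - (?X o\<^sub>L ?X))"
    by (subst sqrt_iter.simps(2)[of B "Suc n"], subst (3) sqrt_iter.simps(2)[of B n])
       (simp del: sqrt_iter.simps add: scaleR_diff_right scaleR_add_right)
  also have "\<dots> = (1/2) *\<^sub>R ((?Y + ?X) o\<^sub>L (?Y - ?X))"
    by (rule blinfun_eqI)
       (simp del: sqrt_iter.simps add: com blinfun.add_left blinfun.scaleR_left blinfun.diff_left blinfun.diff_right)
  finally have "norm (sqrt_iter B (Suc (Suc n)) - ?Y) = norm ((?Y + ?X) o\<^sub>L (?Y - ?X)) / 2"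
    by simp
  also have "\<dots> \<le> (?y + ?x) * (?y - ?x) / 2"
  proof -
    have "norm (?Y + ?X) \<le> ?y + ?x"
      using norm_triangle_ineq[of ?Y ?X] norm_sqrt_iter_le[OF assms, of n]
        norm_sqrt_iter_le[OF assms, of "Suc n"] by linarith
    then have "norm (?Y + ?X) * norm (?Y - ?X) \<le> (?y + ?x) * (?y - ?x)"
      using Suc sqrt_iter_bound_range(1)[of n] sqrt_iter_bound_range(1)[of "Suc n"]
      by (intro mult_mono) (auto simp del: sqrt_iter.simps sqrt_iter_bound.simps)
    then show ?thesis using norm_blinfun_compose[of "?Y + ?X" "?Y - ?X"] by linarith
  qed
  also have "\<dots> = sqrt_iter_bound (Suc (Suc n)) - ?y"
    by (simp only: sqrt_iter_bound.simps(2)[of "Suc n"] sqrt_iter_bound.simps(2)[of n])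
       (simp add: power2_eq_square field_simps)
  finally show ?case .
qed

lemma sqrt_iter_convergent:
  fixes B :: "'a::{real_inner,banach} \<Rightarrow>\<^sub>L 'a"
  assumes "norm B \<le> 1"
  obtains X where "sqrt_iter B \<longlonglongrightarrow> X"
proof -
  have "summable (\<lambda>n. sqrt_iter_bound (Suc n) - sqrt_iter_bound n)"
  proof (rule bounded_imp_summable)
    show "0 \<le> sqrt_iter_bound (Suc n) - sqrt_iter_bound n" for n
      using sum_power2_ge_zero[of "sqrt_iter_bound n - 1" 0]
      by (simp add: power2_eq_square field_simps)
    show "(\<Sum>k\<le>n. sqrt_iter_bound (Suc k) - sqrt_iter_bound k) \<le> 1" for n
      using sqrt_iter_bound_range(2)[of "Suc n"] sum_telescope[of "\<lambda>k. - sqrt_iter_bound k" n]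
      by (simp del: sqrt_iter_bound.simps(2))
  qed
  then have "summable (\<lambda>n. sqrt_iter B (Suc n) - sqrt_iter B n)"
    by (rule summable_comparison_test'[where N = 0]) (rule norm_sqrt_iter_diff_le[OF assms])
  then have "convergent (\<lambda>n. \<Sum>k<n. sqrt_iter B (Suc k) - sqrt_iter B k)"
    by (simp add: summable_iff_convergent)
  also have "(\<lambda>n. \<Sum>k<n. sqrt_iter B (Suc k) - sqrt_iter B k) = sqrt_iter B"
    by (subst sum_lessThan_telescope) simp
  finally show ?thesis using that by (auto simp: convergent_def)
qed

text \<open>The square root of \<open>A\<close> is \<open>sqrt K (1 - X)\<close>, where \<open>X\<close> is the limit of the iteration for
  \<open>B = 1 - A / K\<close>. It commutes with every operator that commutes with \<open>A\<close>, which is what uniqueness and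
  complex linearity need.\<close>

lemma psd_op_sqrt_exists:
  fixes A :: "'a::{real_inner,banach} \<Rightarrow>\<^sub>L 'a"
  assumes "psd_op A"
  obtains R where "psd_op R" "R o\<^sub>L R = A" "\<And>S. S o\<^sub>L A = A o\<^sub>L S \<Longrightarrow> S o\<^sub>L R = R o\<^sub>L S"
proof -
  \<comment> \<open>the summand \<open>1\<close> keeps \<open>K\<close> positive when \<open>A = 0\<close>\<close>
  define K where "K = norm A + 1"
  have K: "K > 0" by (simp add: K_def add_nonneg_pos)
  define B where "B = id_blinfun - (1/K) *\<^sub>R A"
  have Bx: "B x = x - (1/K) *\<^sub>R A x" for x by (simp add: B_def blinfun.diff_left blinfun.scaleR_left)
  have Asym: "inner (A x) y = inner x (A y)" for x y using assms by (simp add: psd_op_def symmetric_op_def)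
  have Apos: "0 \<le> inner x (A x)" for x using assms by (simp add: psd_op_def)
  have Ale: "inner x (A x) \<le> K * (norm x)\<^sup>2" for x
  proof -
    have "inner x (A x) \<le> norm x * norm (A x)" by (rule norm_cauchy_schwarz)
    also have "\<dots> \<le> norm x * (norm A * norm x)" by (intro mult_left_mono norm_blinfun) auto
    also have "\<dots> \<le> K * (norm x)\<^sup>2" by (simp add: K_def power2_eq_square algebra_simps)
    finally show ?thesis .
  qed
  have Bsym: "symmetric_op B"
    by (simp add: symmetric_op_def Bx inner_diff_left inner_diff_right Asym)
  have "psd_op B"
    using Bsym Ale K by (simp add: psd_op_def Bx inner_diff_right divide_le_eq power2_norm_eq_inner mult.commute)
  moreover have "inner x (B x) \<le> (norm x)\<^sup>2" for x
    using Apos[of x] K by (simp add: Bx inner_diff_right power2_norm_eq_inner)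
  ultimately have B1: "norm B \<le> 1" by (rule norm_le_one_if_between_0_and_id)
  obtain X where X: "sqrt_iter B \<longlonglongrightarrow> X" using sqrt_iter_convergent[OF B1] .
  note compose = bounded_bilinear.tendsto[OF bounded_bilinear_blinfun_compose]
  have lim_apply: "(\<lambda>n. sqrt_iter B n x) \<longlonglongrightarrow> X x" for x
    by (intro blinfun.tendsto X tendsto_const)
  have "(\<lambda>n. sqrt_iter B (Suc n)) \<longlonglongrightarrow> (1/2) *\<^sub>R (B + (X o\<^sub>L X))"
    unfolding sqrt_iter.simps by (intro tendsto_intros compose X)
  then have fix_X: "X = (1/2) *\<^sub>R (B + (X o\<^sub>L X))"
    using LIMSEQ_Suc[OF X] LIMSEQ_unique by blast
  have X1: "norm X \<le> 1"
    using norm_sqrt_iter_le[OF B1] sqrt_iter_bound_range(2)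
    by (intro LIMSEQ_le_const2[OF tendsto_norm[OF X]]) (meson order_trans)
  have "symmetric_op (sqrt_iter B n)" for n
    using Bsym by (induction n) (auto simp: symmetric_op_def blinfun.add_left blinfun.scaleR_left inner_add_left inner_add_right)
  then have Xsym: "inner (X x) y = inner x (X y)" for x y
    using tendsto_inner[OF lim_apply[of x] tendsto_const[of y]]
      tendsto_inner[OF tendsto_const[of x] lim_apply[of y]] LIMSEQ_unique
    by (auto simp: symmetric_op_def)
  define R where "R = sqrt K *\<^sub>R (id_blinfun - X)"
  have Rx: "R x = sqrt K *\<^sub>R (x - X x)" for x
    by (simp add: R_def blinfun.diff_left blinfun.scaleR_left)
  have "inner x (X x) \<le> inner x x" for x
  proof -
    have "inner x (X x) \<le> norm x * norm (X x)" by (rule norm_cauchy_schwarz)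
    also have "\<dots> \<le> norm x * (norm X * norm x)" by (intro mult_left_mono norm_blinfun) auto
    also have "\<dots> \<le> norm x * (1 * norm x)" by (intro mult_left_mono mult_right_mono X1) auto
    finally show ?thesis by (simp add: power2_eq_square flip: power2_norm_eq_inner)
  qed
  then have "psd_op R"
    using K by (simp add: psd_op_def symmetric_op_def Rx inner_diff_left inner_diff_right Xsym)
  moreover have "R o\<^sub>L R = A"
  proof (rule blinfun_eqI)
    fix x
    have "2 *\<^sub>R X x = 2 *\<^sub>R ((1/2) *\<^sub>R (B + (X o\<^sub>L X))) x"
      by (rule arg_cong[OF fix_X, of "\<lambda>T. 2 *\<^sub>R T x"])
    also have "\<dots> = B x + X (X x)" by (simp add: blinfun.add_left blinfun.scaleR_left)
    finally have "2 *\<^sub>R X x = B x + X (X x)" .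
    then have "x - B x = x - 2 *\<^sub>R X x + X (X x)" by (simp only: diff_diff_eq2 diff_add_eq) simp
    moreover have "A x = K *\<^sub>R (x - B x)" using K by (simp add: Bx)
    ultimately have "A x = K *\<^sub>R (x - 2 *\<^sub>R X x + X (X x))" by (simp only:)
    also have "\<dots> = R (R x)"
      using K by (simp add: Rx blinfun.scaleR_right blinfun.diff_right scaleR_2 algebra_simps
        flip: real_sqrt_mult)
    finally show "(R o\<^sub>L R) x = A x" by simp
  qed
  moreover have "S o\<^sub>L R = R o\<^sub>L S" if S: "S o\<^sub>L A = A o\<^sub>L S" for S
  proof -
    have "S (A x) = A (S x)" for x using S by (metis blinfun_apply_blinfun_compose)
    then have "S o\<^sub>L B = B o\<^sub>L S"
      by (intro blinfun_eqI) (simp add: Bx blinfun.diff_right blinfun.scaleR_right)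
    then have "(\<lambda>n. S o\<^sub>L sqrt_iter B n) = (\<lambda>n. sqrt_iter B n o\<^sub>L S)"
      using sqrt_iter_commute by blast
    moreover have "(\<lambda>n. S o\<^sub>L sqrt_iter B n) \<longlonglongrightarrow> (S o\<^sub>L X)"
      "(\<lambda>n. sqrt_iter B n o\<^sub>L S) \<longlonglongrightarrow> (X o\<^sub>L S)"
      by (intro compose X tendsto_const)+
    ultimately have "S o\<^sub>L X = X o\<^sub>L S" using LIMSEQ_unique by metis
    then have "S (X x) = X (S x)" for x by (metis blinfun_apply_blinfun_compose)
    then show ?thesis by (intro blinfun_eqI) (simp add: Rx blinfun.diff_right blinfun.scaleR_right)
  qed
  ultimately show ?thesis using that by blast
qed

section \<open>Factorization through an operator with larger norm\<close>

lemma orthogonal_closure_iff: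
  fixes x :: "'a::real_inner"
  shows "(\<forall>v\<in>closure V. inner v x = 0) \<longleftrightarrow> (\<forall>v\<in>V. inner v x = 0)"
proof
  assume "\<forall>v\<in>V. inner v x = 0"
  then have "V \<subseteq> {v. inner v x = 0}" by blast
  moreover have "closed {v. inner v x = 0}"
    by (intro closed_Collect_eq continuous_intros)
  ultimately show "\<forall>v\<in>closure V. inner v x = 0" using closure_minimal by blast
qed (use closure_subset in blast)

lemma subspace_closure:
  fixes V :: "'a::real_normed_vector set"
  assumes "subspace V"
  shows "subspace (closure V)"
  unfolding subspace_def
proof (intro conjI ballI allI)
  show "0 \<in> closure V" using assms closure_subset subspace_0 by blast
  fix x assume "x \<in> closure V"
  then obtain a where a: "\<And>n. a n \<in> V" "a \<longlonglongrightarrow> x" unfolding closure_sequential by blast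
  show "c *\<^sub>R x \<in> closure V" for c
    unfolding closure_sequential using a assms
    by (intro exI[of _ "\<lambda>n. c *\<^sub>R a n"]) (auto intro: subspace_mul tendsto_intros)
  fix y assume "y \<in> closure V"
  then obtain b where b: "\<And>n. b n \<in> V" "b \<longlonglongrightarrow> y" unfolding closure_sequential by blast
  show "x + y \<in> closure V"
    unfolding closure_sequential using a b assms
    by (intro exI[of _ "\<lambda>n. a n + b n"]) (auto intro: subspace_add tendsto_intros)
qed

lemma subspace_closure_range_blinfun:
  fixes R :: "'a::real_normed_vector \<Rightarrow>\<^sub>L 'b::real_normed_vector"
  shows "subspace (closure (range R))"
  by (intro subspace_closure linear_subspace_image subspace_UNIV bounded_linear.linear
      blinfun.bounded_linear_right)

lemma range_decomposition:
  fixes R :: "'b::real_normed_vector \<Rightarrow>\<^sub>L 'a::{real_inner,banach}"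
  obtains v where "v \<in> closure (range R)" "\<And>h. inner (R h) (x - v) = 0"
proof -
  obtain v where v: "v \<in> closure (range R)" "\<And>u. u \<in> closure (range R) \<Longrightarrow> inner (x - v) u = 0"
    using orthogonal_projection_exists[OF closed_closure subspace_closure_range_blinfun, of R x]
    by blast
  have "inner (R h) (x - v) = 0" for h
    using v(2)[of "R h"] closure_subset[of "range R"] by (auto simp: inner_commute)
  then show ?thesis using v(1) that by blast
qed

lemma blinfun_eqI_range:
  fixes R :: "'b::real_normed_vector \<Rightarrow>\<^sub>L 'a::{real_inner,banach}"
    and C D :: "'a \<Rightarrow>\<^sub>L 'c::real_normed_vector"
  assumes "\<And>h. C (R h) = D (R h)" "\<And>x. (\<And>h. inner (R h) x = 0) \<Longrightarrow> C x = D x"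
  shows "C = D"
proof (rule blinfun_eqI)
  fix x
  obtain v where v: "v \<in> closure (range R)" "\<And>h. inner (R h) (x - v) = 0"
    using range_decomposition by metis
  have "closed {v. C v = D v}" by (intro closed_Collect_eq continuous_intros)
  then have "closure (range R) \<subseteq> {v. C v = D v}" using assms(1) by (intro closure_minimal) auto
  then have "C v = D v" using v by blast
  moreover have "C (x - v) = D (x - v)" using v by (intro assms(2)) auto
  ultimately show "C x = D x" by (simp add: blinfun.diff_right)
qed

text \<open>Douglas' factorization. The graph of the factor on the closed range of \<open>R\<close> is the closure
  \<open>G\<close> of the set of all pairs \<open>(R h, T h)\<close>.\<close>

lemma douglas_factorization:
  fixes R :: "'b::real_normed_vector \<Rightarrow>\<^sub>L 'a::{real_inner,banach}" and T :: "'b \<Rightarrow>\<^sub>L 'c::banach"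
  assumes k: "0 \<le> k" and le: "\<And>h. norm (T h) \<le> k * norm (R h)"
  obtains C :: "'a \<Rightarrow>\<^sub>L 'c" where "\<And>h. C (R h) = T h" "\<And>x. (\<And>h. inner (R h) x = 0) \<Longrightarrow> C x = 0"
    "norm C \<le> k" "range C \<subseteq> closure (range T)"
proof -
  define G where "G = closure (range (\<lambda>h. (R h, T h)))"
  have "subspace (range (\<lambda>h. (R h, T h)))"
    by (intro linear_subspace_image subspace_UNIV bounded_linear.linear bounded_linear_Pair
        blinfun.bounded_linear_right)
  then have G: "subspace G" unfolding G_def by (rule subspace_closure)
  have G_le: "norm w \<le> k * norm v" if "(v, w) \<in> G" for v w
  proof -
    have "closed {p :: 'a \<times> 'c. norm (snd p) \<le> k * norm (fst p)}"
      by (intro closed_Collect_le continuous_intros)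
    then have "G \<subseteq> {p. norm (snd p) \<le> k * norm (fst p)}"
      unfolding G_def using le by (intro closure_minimal) auto
    then show ?thesis using that by auto
  qed
  have G_ran: "w \<in> closure (range T)" if "(v, w) \<in> G" for v w
  proof -
    have "range (\<lambda>h. (R h, T h)) \<subseteq> UNIV \<times> closure (range T)" using closure_subset by fastforce
    then have "G \<subseteq> UNIV \<times> closure (range T)"
      unfolding G_def by (intro closure_minimal) (auto intro!: closed_Times)
    then show ?thesis using that by auto
  qed
  have G_ex: "\<exists>w. (v, w) \<in> G" if "v \<in> closure (range R)" for v
  proof -
    obtain h where h: "(\<lambda>n. R (h n)) \<longlonglongrightarrow> v"
    proof -
      obtain a where a: "\<And>n. a n \<in> range R" "a \<longlonglongrightarrow> v"
        using \<open>v \<in> closure (range R)\<close> unfolding closure_sequential by blast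
      then have "\<forall>n. \<exists>h. a n = R h" by blast
      then obtain h where "\<forall>n. a n = R (h n)" by (rule choice[THEN exE])
      then have "a = (\<lambda>n. R (h n))" by blast
      then show ?thesis using a(2) that by blast
    qed
    have "Cauchy (\<lambda>n. T (h n))"
    proof (rule CauchyI)
      fix e :: real assume "e > 0"
      then have "e / (k + 1) > 0" using k by simp
      moreover have "Cauchy (\<lambda>n. R (h n))" using h LIMSEQ_imp_Cauchy by blast
      ultimately obtain M where M: "\<And>i j. i \<ge> M \<Longrightarrow> j \<ge> M \<Longrightarrow> norm (R (h i) - R (h j)) < e / (k + 1)"
        using CauchyD by metis
      show "\<exists>M. \<forall>m\<ge>M. \<forall>n\<ge>M. norm (T (h m) - T (h n)) < e"
      proof (intro exI[of _ M] allI impI)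
        fix i j assume "i \<ge> M" "j \<ge> M"
        have "norm (T (h i) - T (h j)) \<le> k * norm (R (h i) - R (h j))"
          using le[of "h i - h j"] by (simp add: blinfun.diff_right)
        also have "\<dots> \<le> k * (e / (k + 1))" using M[OF \<open>i \<ge> M\<close> \<open>j \<ge> M\<close>] k by (intro mult_left_mono) auto
        also have "\<dots> < e" using k \<open>e > 0\<close> by (simp add: field_simps)
        finally show "norm (T (h i) - T (h j)) < e" .
      qed
    qed
    then obtain w where "(\<lambda>n. T (h n)) \<longlonglongrightarrow> w" using Cauchy_convergent convergent_def by blast
    then have "(\<lambda>n. (R (h n), T (h n))) \<longlonglongrightarrow> (v, w)" using h by (intro tendsto_Pair)
    then have "(v, w) \<in> G"
      unfolding G_def closure_sequential by (intro exI[of _ "\<lambda>n. (R (h n), T (h n))"]) auto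
    then show ?thesis ..
  qed
  \<comment> \<open>\<open>K x w\<close>: the projection \<open>v\<close> of \<open>x\<close> to the closed range of \<open>R\<close> is mapped to \<open>w\<close>\<close>
  define K where "K x w \<longleftrightarrow> (\<exists>v. (v, w) \<in> G \<and> (\<forall>h. inner (R h) (x - v) = 0))" for x w
  have K_le: "norm w \<le> k * norm x" if K: "K x w" for x w
  proof -
    obtain v where v: "(v, w) \<in> G" "\<And>h. inner (R h) (x - v) = 0" using K unfolding K_def by blast
    have "fst ` G \<subseteq> closure (fst ` range (\<lambda>h. (R h, T h)))" unfolding G_def
      by (intro image_closure_subset continuous_intros closed_closure closure_subset)
    then have "v \<in> closure (range R)" using v(1) by (force simp: image_image)
    then have "inner v (x - v) = 0" using v(2) orthogonal_closure_iff[of "range R" "x - v"] by auto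
    then have "(norm x)\<^sup>2 = (norm v)\<^sup>2 + (norm (x - v))\<^sup>2"
      by (simp add: power2_norm_eq_inner inner_diff_right inner_diff_left inner_commute)
    then have "(norm v)\<^sup>2 \<le> (norm x)\<^sup>2" by simp
    then have "norm v \<le> norm x" by simp
    then show ?thesis using G_le[OF v(1)] k by (meson mult_left_mono order_trans)
  qed
  have K_ex: "\<exists>w. K x w" for x
    using range_decomposition[of R x] G_ex unfolding K_def by metis
  have K_add: "K (x + y) (w + z)" if K: "K x w" "K y z" for x y w z
  proof -
    obtain v v' where v: "(v, w) \<in> G" "(v', z) \<in> G"
      "\<And>h. inner (R h) (x - v) = 0" "\<And>h. inner (R h) (y - v') = 0"
      using K unfolding K_def by blast
    have "(v + v', w + z) \<in> G" using subspace_add[OF G v(1,2)] by simp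
    moreover have "inner (R h) (x + y - (v + v')) = 0" for h
      using v(3,4)[of h] by (simp add: inner_diff_right inner_add_right)
    ultimately show ?thesis unfolding K_def by blast
  qed
  have K_scale: "K (r *\<^sub>R x) (r *\<^sub>R w)" if K: "K x w" for x w r
  proof -
    obtain v where v: "(v, w) \<in> G" "\<And>h. inner (R h) (x - v) = 0" using K unfolding K_def by blast
    have "(r *\<^sub>R v, r *\<^sub>R w) \<in> G" using subspace_mul[OF G v(1), of r] by simp
    moreover have "inner (R h) (r *\<^sub>R x - r *\<^sub>R v) = 0" for h
      using v(2)[of h] by (simp flip: scaleR_diff_right)
    ultimately show ?thesis unfolding K_def by blast
  qed
  have K_unique: "w = z" if "K x w" "K x z" for x w z
  proof -
    have "K (x + (-1) *\<^sub>R x) (w + (-1) *\<^sub>R z)" by (intro K_add K_scale that)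
    from K_le[OF this] show ?thesis by simp
  qed
  obtain c where c: "\<And>x. K x (c x)" using K_ex by metis
  have "bounded_linear c"
  proof (rule bounded_linear_intro[of _ k])
    show "c (x + y) = c x + c y" for x y by (rule K_unique[OF c K_add[OF c c]])
    show "c (r *\<^sub>R x) = r *\<^sub>R c x" for r x by (rule K_unique[OF c K_scale[OF c]])
    show "norm (c x) \<le> norm x * k" for x using K_le[OF c] by (simp add: mult.commute)
  qed
  then have app: "Blinfun c x = c x" for x by (simp add: bounded_linear_Blinfun_apply)
  show ?thesis
  proof
    show "Blinfun c (R h) = T h" for h
    proof -
      have "(R h, T h) \<in> G" unfolding G_def by (rule subsetD[OF closure_subset]) blast
      then have "K (R h) (T h)" unfolding K_def by (intro exI[of _ "R h"]) auto
      then show ?thesis using K_unique[OF c] app by simp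
    qed
    show "Blinfun c x = 0" if "\<And>h. inner (R h) x = 0" for x
    proof -
      have "(0, 0) \<in> G" using subspace_0[OF G] by (simp add: zero_prod_def)
      then have "K x 0" unfolding K_def using that by (intro exI[of _ 0]) auto
      then show ?thesis using K_unique[OF c] app by simp
    qed
    show "norm (Blinfun c) \<le> k" using k K_le c by (intro norm_blinfun_bound) (auto simp: app)
    show "range (Blinfun c) \<subseteq> closure (range T)"
      using c G_ran unfolding K_def app by blast
  qed
qed

section \<open>Complex-linear operators in terms of the real inner product\<close>

lemma blinfun_eq_iff: "S = T \<longleftrightarrow> (\<forall>x. blinfun_apply S x = T x)"
  by (auto intro: blinfun_eqI)

lemma cinner_scaleC_left: "cinner (a *\<^sub>C x) y = cnj a * cinner x (y::'a::chilbert_space)"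
proof -
  have "cinner (a *\<^sub>C x) y = cnj (cinner y (a *\<^sub>C x))" by (rule cinner_commute)
  also have "\<dots> = cnj a * cnj (cinner y x)" by (simp add: cinner_scaleC_right)
  also have "cnj (cinner y x) = cinner x y" by (rule cinner_commute[symmetric])
  finally show ?thesis .
qed

lemma scaleC_i_i [simp]: "\<i> *\<^sub>C \<i> *\<^sub>C x = - (x::'a::chilbert_space)"
  using scaleC_of_real[of "-1" x] by (simp add: scaleC_scaleC)

lemma inner_scaleC_i_left: "inner (\<i> *\<^sub>C x) y = - inner x (\<i> *\<^sub>C (y::'a::chilbert_space))"
  by (simp add: inner_eq_Re_cinner cinner_scaleC_left cinner_scaleC_right)

lemma inner_scaleC_i_i [simp]: "inner (\<i> *\<^sub>C x) (\<i> *\<^sub>C y) = inner x (y::'a::chilbert_space)"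
  by (simp add: inner_scaleC_i_left)

lemma cinner_eq_Complex: "cinner x y = Complex (inner x y) (inner (\<i> *\<^sub>C x) (y::'a::chilbert_space))"
  by (simp add: complex_eq_iff inner_eq_Re_cinner cinner_scaleC_left)

lemma scaleC_eq_Re_Im: "a *\<^sub>C x = Re a *\<^sub>R x + Im a *\<^sub>R (\<i> *\<^sub>C (x::'a::chilbert_space))"
proof -
  have "a *\<^sub>C x = (complex_of_real (Re a) + complex_of_real (Im a) * \<i>) *\<^sub>C x"
    by (metis complex_eq mult.commute)
  then show ?thesis by (simp add: scaleC_add_left scaleC_of_real flip: scaleC_scaleC)
qed

lemma scaleC_i_scaleR: "\<i> *\<^sub>C r *\<^sub>R x = r *\<^sub>R \<i> *\<^sub>C (x::'a::chilbert_space)"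
  by (simp add: scaleC_scaleC mult.commute flip: scaleC_of_real)

lemma bounded_linear_scaleC_i: "bounded_linear (\<lambda>x::'a::chilbert_space. \<i> *\<^sub>C x)"
  by (rule bounded_linear_intro[of _ 1])
     (auto simp: scaleC_add_right scaleC_i_scaleR norm_eq_sqrt_inner)

lemma scaleC_i_zero [simp]: "\<i> *\<^sub>C 0 = (0::'a::chilbert_space)"
  by (rule linear_0[OF bounded_linear.linear[OF bounded_linear_scaleC_i]])

lemma scaleC_i_minus [simp]: "\<i> *\<^sub>C (- x) = - (\<i> *\<^sub>C (x::'a::chilbert_space))"
  by (rule linear_neg[OF bounded_linear.linear[OF bounded_linear_scaleC_i]])

text \<open>Multiplication by the imaginary unit as a bounded real-linear operator.\<close>

definition imag_op :: "'a::chilbert_space \<Rightarrow>\<^sub>L 'a" where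
  "imag_op = Blinfun (\<lambda>x. \<i> *\<^sub>C x)"

lemma imag_op_apply [simp]: "imag_op x = \<i> *\<^sub>C x"
  by (simp add: imag_op_def bounded_linear_Blinfun_apply bounded_linear_scaleC_i)

lemma bounded_ops_iff: "T \<in> bounded_ops \<longleftrightarrow> (\<forall>x. T (\<i> *\<^sub>C x) = \<i> *\<^sub>C T x)"
proof
  assume i: "\<forall>x. T (\<i> *\<^sub>C x) = \<i> *\<^sub>C T x"
  have "T (a *\<^sub>C x) = a *\<^sub>C T x" for a x
    unfolding scaleC_eq_Re_Im[of a] by (simp add: i blinfun.add_right blinfun.scaleR_right)
  then show "T \<in> bounded_ops" by (simp add: bounded_ops_def)
qed (simp add: bounded_ops_def)

lemma bounded_ops_compose: "S \<in> bounded_ops \<Longrightarrow> T \<in> bounded_ops \<Longrightarrow> S o\<^sub>L T \<in> bounded_ops"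
  by (simp add: bounded_ops_iff)

lemma bounded_ops_commute_imag_op: "T \<in> bounded_ops \<longleftrightarrow> imag_op o\<^sub>L T = T o\<^sub>L imag_op"
  unfolding bounded_ops_iff blinfun_eq_iff by (auto simp: eq_commute)

lemma op_le_onD: "op_le_on V S T \<Longrightarrow> x \<in> V \<Longrightarrow> inner x (S x) \<le> inner x (T x)"
  by (auto simp: op_le_on_def cinner_eq_Complex complex_nonneg_Reals_iff blinfun.diff_left
        inner_diff_right)

text \<open>Symmetric complex-linear operators have real quadratic forms, so that the order reduces to the
  real inner product.\<close>

lemma op_le_onI:
  assumes "S \<in> bounded_ops" "T \<in> bounded_ops" "symmetric_op S" "symmetric_op T"
    "\<And>x. x \<in> V \<Longrightarrow> inner x (S x) \<le> inner x (T x)"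
  shows "op_le_on V S T"
proof -
  have "inner (\<i> *\<^sub>C x) (A x) = 0" if "A \<in> bounded_ops" "symmetric_op A" for A x
  proof -
    have "inner (\<i> *\<^sub>C x) (A x) = inner (A (\<i> *\<^sub>C x)) x" using that by (simp add: symmetric_op_def)
    also have "\<dots> = - inner (A x) (\<i> *\<^sub>C x)"
      using that by (simp add: bounded_ops_iff inner_scaleC_i_left)
    finally show ?thesis by (simp add: inner_commute)
  qed
  note im = this[OF assms(1,3)] this[OF assms(2,4)]
  show ?thesis
    using assms(5) by (auto simp: op_le_on_def cinner_eq_Complex complex_nonneg_Reals_iff
        blinfun.diff_left inner_diff_right im)
qed

lemma zero_in_bounded_ops [simp]: "0 \<in> bounded_ops"
  by (simp add: bounded_ops_iff)

lemma id_in_bounded_ops [simp]: "id_blinfun \<in> bounded_ops"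
  by (simp add: bounded_ops_iff)

lemma scaleR_in_bounded_ops: "T \<in> bounded_ops \<Longrightarrow> r *\<^sub>R T \<in> bounded_ops"
  by (simp add: bounded_ops_iff blinfun.scaleR_left scaleC_i_scaleR)

lemma symmetric_op_0 [simp]: "symmetric_op 0"
  by (simp add: symmetric_op_def)

text \<open>A complex-linear operator with real quadratic form is symmetric, by polarization.\<close>

lemma positive_ops_iff: "T \<in> positive_ops \<longleftrightarrow> T \<in> bounded_ops \<and> psd_op T"
proof
  assume T: "T \<in> positive_ops"
  then have b: "T \<in> bounded_ops" and le: "op_le_on UNIV 0 T" by (auto simp: positive_ops_def)
  have im: "inner (\<i> *\<^sub>C x) (T x) = 0" for x
    using le by (auto simp: op_le_on_def cinner_eq_Complex complex_nonneg_Reals_iff)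
  have im2: "inner (\<i> *\<^sub>C x) (T y) = - inner (\<i> *\<^sub>C y) (T x)" for x y
    using im[of "x + y"] im[of x] im[of y]
    by (simp add: scaleC_add_right blinfun.add_right inner_add_left inner_add_right)
  have "inner (T x) y = inner x (T y)" for x y
    using im2[of "- (\<i> *\<^sub>C x)" y] b
    by (simp add: bounded_ops_iff blinfun.minus_right inner_commute)
  then show "T \<in> bounded_ops \<and> psd_op T"
    using b op_le_onD[OF le] by (simp add: psd_op_def symmetric_op_def)
next
  assume "T \<in> bounded_ops \<and> psd_op T"
  then show "T \<in> positive_ops" unfolding positive_ops_def
    by (auto intro!: op_le_onI simp: psd_op_def)
qed

lemma inner_eqI:
  fixes x y :: "'a::real_inner"
  assumes "\<And>z. inner z x = inner z y"
  shows "x = y"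
proof -
  have "inner (x - y) (x - y) = 0" using assms[of "x - y"] by (simp add: inner_diff_right)
  then show ?thesis by simp
qed

lemma cadjoint_eqI:
  assumes "T \<in> bounded_ops" "S \<in> bounded_ops" "\<And>x y. inner (T x) y = inner x (S y)"
  shows "cadjoint T = S"
  unfolding cadjoint_def
proof (rule the_equality)
  have "T (\<i> *\<^sub>C x) = \<i> *\<^sub>C T x" for x using assms(1) by (simp add: bounded_ops_iff)
  then show "S \<in> bounded_ops \<and> (\<forall>x y. cinner (T x) y = cinner x (S y))"
    using assms by (simp add: cinner_eq_Complex flip: assms(3))
next
  fix S' :: "'a \<Rightarrow>\<^sub>L 'a"
  assume S': "S' \<in> bounded_ops \<and> (\<forall>x y. cinner (T x) y = cinner x (S' y))"
  show "S' = S"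
  proof (rule blinfun_eqI, rule inner_eqI)
    fix y z
    have "inner (T z) y = inner z (S' y)" using S' by (simp add: inner_eq_Re_cinner)
    then show "inner z (S' y) = inner z (S y)" using assms(3) by simp
  qed
qed

lemma cadjoint:
  assumes "T \<in> bounded_ops"
  shows cadjoint_in_bounded_ops: "cadjoint T \<in> bounded_ops"
    and inner_cadjoint: "inner (T x) y = inner x (cadjoint T y)"
proof -
  obtain S :: "'a \<Rightarrow>\<^sub>L 'a" where "\<forall>x y. inner (T x) y = inner x (S y)"
    using blinfun_adjoint_exists[of T] by blast
  then have S: "inner (T x) y = inner x (S y)" for x y by blast
  have "S (\<i> *\<^sub>C y) = \<i> *\<^sub>C S y" for y
  proof (rule inner_eqI)
    fix z
    have "inner z (S (\<i> *\<^sub>C y)) = - inner (\<i> *\<^sub>C T z) y" by (simp add: inner_scaleC_i_left flip: S)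
    also have "\<dots> = - inner (\<i> *\<^sub>C z) (S y)" using assms by (simp add: bounded_ops_iff flip: S)
    finally show "inner z (S (\<i> *\<^sub>C y)) = inner z (\<i> *\<^sub>C S y)" by (simp add: inner_scaleC_i_left)
  qed
  then have S': "S \<in> bounded_ops" by (simp add: bounded_ops_iff)
  have "cadjoint T = S" by (rule cadjoint_eqI[OF assms S' S])
  then show "cadjoint T \<in> bounded_ops" "inner (T x) y = inner x (cadjoint T y)" using S S' by auto
qed

lemma cadjoint_eq_self_iff:
  assumes "T \<in> bounded_ops"
  shows "cadjoint T = T \<longleftrightarrow> symmetric_op T"
proof
  assume "cadjoint T = T"
  then show "symmetric_op T" using inner_cadjoint[OF assms] by (simp add: symmetric_op_def)
qed (auto intro!: cadjoint_eqI assms simp: symmetric_op_def)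

lemma op_sqrt_eqI:
  assumes T: "T \<in> positive_ops" and R: "R \<in> positive_ops" "R o\<^sub>L R = T"
  shows "op_sqrt T = R"
proof -
  have "psd_op T" using T by (simp add: positive_ops_iff)
  then obtain Q where Q: "psd_op Q" "Q o\<^sub>L Q = T" "\<And>S. S o\<^sub>L T = T o\<^sub>L S \<Longrightarrow> S o\<^sub>L Q = Q o\<^sub>L S"
    using psd_op_sqrt_exists[of T] by blast
  have "S = Q" if S: "S \<in> positive_ops \<and> S o\<^sub>L S = T" for S
  proof (rule psd_op_sqrt_unique)
    have "S (S x) = T x" for x using S by auto
    then show "S o\<^sub>L Q = Q o\<^sub>L S" by (intro Q(3) blinfun_eqI) (simp flip: \<open>\<And>x. S (S x) = T x\<close>)
  qed (use S Q(1,2) in \<open>auto simp: positive_ops_iff\<close>)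
  then show ?thesis unfolding op_sqrt_def using R by (intro the_equality) blast+
qed

lemma op_sqrt:
  assumes "T \<in> positive_ops"
  shows op_sqrt_positive: "op_sqrt T \<in> positive_ops"
    and op_sqrt_square: "op_sqrt T o\<^sub>L op_sqrt T = T"
proof -
  have T: "psd_op T" "T \<in> bounded_ops" using assms by (auto simp: positive_ops_iff)
  obtain Q where Q: "psd_op Q" "Q o\<^sub>L Q = T" "\<And>S. S o\<^sub>L T = T o\<^sub>L S \<Longrightarrow> S o\<^sub>L Q = Q o\<^sub>L S"
    using psd_op_sqrt_exists[OF T(1)] by blast
  have "Q \<in> bounded_ops"
    using Q(3)[of imag_op] T(2) by (simp add: bounded_ops_commute_imag_op)
  then have "Q \<in> positive_ops" using Q(1) by (simp add: positive_ops_iff)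
  moreover from this have "op_sqrt T = Q" using Q(2) assms by (intro op_sqrt_eqI)
  ultimately show "op_sqrt T \<in> positive_ops" "op_sqrt T o\<^sub>L op_sqrt T = T" using Q(2) by auto
qed

lemma op_sqrt_id [simp]: "op_sqrt (id_blinfun :: 'a::chilbert_space \<Rightarrow>\<^sub>L 'a) = id_blinfun"
  by (intro op_sqrt_eqI) (auto simp: positive_ops_iff psd_op_def symmetric_op_def blinfun_eq_iff)

section \<open>Operators between closed ranges\<close>

lemma orth_compl_closure_range:
  assumes "R \<in> bounded_ops"
  shows "orth_compl (closure (range R)) = {x. \<forall>h. inner (R h) x = 0}"
proof (intro equalityI subsetI)
  fix x assume "x \<in> orth_compl (closure (range R))"
  then have "cinner (R h) x = 0" for h
    unfolding orth_compl_def using closure_subset[of "range R"] by auto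
  then show "x \<in> {x. \<forall>h. inner (R h) x = 0}" by (simp add: inner_eq_Re_cinner)
next
  fix x assume x: "x \<in> {x. \<forall>h. inner (R h) x = 0}"
  have "\<forall>v\<in>closure (range R). inner v x = 0"
    using x by (subst orthogonal_closure_iff) auto
  moreover have "inner (R h) (\<i> *\<^sub>C x) = 0" for h
    using x assms inner_scaleC_i_left[of "R h" x] by (auto simp: bounded_ops_iff dest: spec[of _ "\<i> *\<^sub>C h"])
  then have "\<forall>v\<in>closure (range R). inner v (\<i> *\<^sub>C x) = 0"
    by (subst orthogonal_closure_iff) auto
  ultimately show "x \<in> orth_compl (closure (range R))"
    by (simp add: orth_compl_def cinner_eq_Complex complex_eq_iff inner_scaleC_i_left)
qed

lemma douglas_ops_between:
  assumes R: "R \<in> bounded_ops" and T: "T \<in> bounded_ops"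
    and k: "0 \<le> k" and le: "\<And>h. norm (T h) \<le> k * norm (R h)"
  obtains C :: "'a::chilbert_space \<Rightarrow>\<^sub>L 'a" where "C \<in> ops_between (closure (range R)) (closure (range T))" "norm C \<le> k"
    "\<And>h. C (R h) = T h"
proof -
  obtain C :: "'a \<Rightarrow>\<^sub>L 'a" where C: "\<And>h. C (R h) = T h" "\<And>x. (\<And>h. inner (R h) x = 0) \<Longrightarrow> C x = 0"
    "norm C \<le> k" "range C \<subseteq> closure (range T)"
    using douglas_factorization[OF k le] by blast
  have "imag_op o\<^sub>L C = C o\<^sub>L imag_op"
  proof (rule blinfun_eqI_range[where R = R])
    fix h
    have "C (\<i> *\<^sub>C R h) = C (R (\<i> *\<^sub>C h))" using R by (simp add: bounded_ops_iff)
    then show "(imag_op o\<^sub>L C) (R h) = (C o\<^sub>L imag_op) (R h)" using T by (simp add: C bounded_ops_iff)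
  next
    fix x assume x: "\<And>h. inner (R h) x = 0"
    have "inner (R h) (\<i> *\<^sub>C x) = 0" for h
      using x[of "\<i> *\<^sub>C h"] R inner_scaleC_i_left[of "R h" x] by (simp add: bounded_ops_iff)
    then show "(imag_op o\<^sub>L C) x = (C o\<^sub>L imag_op) x"
      using x C(2)[of x] C(2)[of "\<i> *\<^sub>C x"]
      by simp
  qed
  then have "C \<in> ops_between (closure (range R)) (closure (range T))"
    using C by (auto simp: ops_between_def bounded_ops_commute_imag_op orth_compl_closure_range[OF R])
  then show ?thesis using that C by blast
qed

lemma ops_between_eqI:
  assumes R: "R \<in> bounded_ops"
    and "C \<in> ops_between (closure (range R)) W" "D \<in> ops_between (closure (range R)) W'"
    and "\<And>h. C (R h) = D (R h)"
  shows "C = D"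
  using assms by (intro blinfun_eqI_range[where R = R]) (auto simp: ops_between_def orth_compl_closure_range)

lemma cadjoint_in_ops_between:
  assumes R: "R \<in> bounded_ops" and T: "T \<in> bounded_ops"
    and C: "C \<in> ops_between (closure (range R)) (closure (range T))"
  shows "cadjoint C \<in> ops_between (closure (range T)) (closure (range R))"
proof -
  have Cb: "C \<in> bounded_ops" using C by (simp add: ops_between_def)
  have "cadjoint C y \<in> closure (range R)" for y
  proof -
    obtain v where v: "v \<in> closure (range R)" "\<And>h. inner (R h) (cadjoint C y - v) = 0"
      using range_decomposition by blast
    define z where "z = cadjoint C y - v"
    have "C z = 0" using C v(2) by (auto simp: z_def ops_between_def orth_compl_closure_range[OF R])
    then have "inner z (cadjoint C y) = 0" by (simp flip: inner_cadjoint[OF Cb])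
    moreover have "inner v z = 0"
      using orthogonal_closure_iff[of "range R" z] v by (auto simp: z_def)
    ultimately have "inner z z = 0" by (simp add: z_def inner_diff_right inner_commute)
    then show ?thesis using v by (simp add: z_def)
  qed
  moreover have "cadjoint C y = 0" if y: "\<forall>h. inner (T h) y = 0" for y
  proof (rule inner_eqI)
    fix z
    have "C z \<in> closure (range T)" using C by (simp add: ops_between_def)
    then have "inner (C z) y = 0" using orthogonal_closure_iff[of "range T" y] y by auto
    then show "inner z (cadjoint C y) = inner z 0" by (simp add: inner_cadjoint[OF Cb])
  qed
  ultimately show ?thesis
    by (auto simp: ops_between_def orth_compl_closure_range[OF T] cadjoint_in_bounded_ops[OF Cb])
qed

lemma ops_between_compose:
  "C \<in> ops_between U V \<Longrightarrow> D \<in> ops_between V' W \<Longrightarrow> D o\<^sub>L C \<in> ops_between U W"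
  by (auto simp: ops_between_def bounded_ops_compose)

lemma ops_between_sum:
  assumes "subspace W" "finite I" "\<And>i. i \<in> I \<Longrightarrow> C i \<in> ops_between V W"
  shows "(\<Sum>i\<in>I. C i) \<in> ops_between V W"
  using assms(2,3)
proof (induction I rule: finite_induct)
  case empty
  then show ?case using subspace_0[OF assms(1)] by (simp add: ops_between_def)
next
  case (insert i I)
  then show ?case
    using assms(1) by (auto simp: ops_between_def bounded_ops_def blinfun.add_left scaleC_add_right subspace_add)
qed

text \<open>The compression \<open>X \<mapsto> R X R\<close> is injective on operators living on the closed range of \<open>R\<close>.\<close>

lemma compression_inj:
  assumes R: "R \<in> positive_ops"
    and C: "C \<in> ops_between (closure (range R)) (closure (range R))"
    and D: "D \<in> ops_between (closure (range R)) (closure (range R))"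
    and eq: "R o\<^sub>L C o\<^sub>L R = R o\<^sub>L D o\<^sub>L R"
  shows "C = D"
proof -
  have Rb: "R \<in> bounded_ops" and sym: "\<And>x y. inner (R x) y = inner x (R y)"
    using R by (auto simp: positive_ops_iff psd_op_def symmetric_op_def)
  have "C (R h) = D (R h)" for h
  proof -
    define v where "v = C (R h) - D (R h)"
    have "R (C (R h)) = R (D (R h))" using eq by (metis blinfun_apply_blinfun_compose)
    then have "inner (R g) v = 0" for g by (simp add: v_def sym blinfun.diff_right)
    moreover have "v \<in> closure (range R)"
      unfolding v_def using C D
      by (intro subspace_diff[OF subspace_closure_range_blinfun]) (auto simp: ops_between_def)
    ultimately have "inner v v = 0" using orthogonal_closure_iff[of "range R" v] by auto
    then show ?thesis by (simp add: v_def)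
  qed
  then show ?thesis using ops_between_eqI[OF Rb C D] by blast
qed

text \<open>A positive operator dominated by \<open>c R\<^sup>2\<close> is a compression \<open>R X R\<close> with \<open>0 \<le> X \<le> c\<close>: factor its
  square root as \<open>C R\<close> and take \<open>X = C\<^sup>* C\<close>.\<close>

lemma compression_exists:
  assumes R: "R \<in> positive_ops" and F: "F \<in> positive_ops" and c: "0 \<le> c"
    and le: "\<And>h. inner h (F h) \<le> c * (norm (R h))\<^sup>2"
  shows "\<exists>X. X \<in> ops_between (closure (range R)) (closure (range R)) \<and> symmetric_op X \<and>
    norm X \<le> c \<and> (\<forall>x. 0 \<le> inner x (X x) \<and> inner x (X x) \<le> c * inner x x) \<and> F = R o\<^sub>L X o\<^sub>L R"
proof -
  have Rb: "R \<in> bounded_ops" and Rsym: "\<And>x y. inner (R x) y = inner x (R y)"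
    using R by (auto simp: positive_ops_iff psd_op_def symmetric_op_def)
  define G where "G = op_sqrt F"
  have G: "G \<in> bounded_ops" "\<And>x y. inner (G x) y = inner x (G y)" "\<And>x. G (G x) = F x"
    using op_sqrt[OF F] by (auto simp: G_def positive_ops_iff psd_op_def symmetric_op_def blinfun_eq_iff)
  have "norm (G h) \<le> sqrt c * norm (R h)" for h
  proof -
    have "(norm (G h))\<^sup>2 = inner h (F h)" by (simp add: power2_norm_eq_inner G)
    also have "\<dots> \<le> (sqrt c * norm (R h))\<^sup>2" using le[of h] c by (simp add: power_mult_distrib)
    finally show ?thesis by (rule power2_le_imp_le) (use c in simp)
  qed
  then obtain C where C: "C \<in> ops_between (closure (range R)) (closure (range G))"
      "norm C \<le> sqrt c" "\<And>h. C (R h) = G h"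
    using douglas_ops_between[OF Rb G(1), of "sqrt c"] c by (metis real_sqrt_ge_zero)
  have Cb: "C \<in> bounded_ops" using C by (simp add: ops_between_def)
  define X where "X = cadjoint C o\<^sub>L C"
  have inner_X: "inner x (X y) = inner (C x) (C y)" for x y
    by (simp add: X_def inner_cadjoint[OF Cb])
  have Cx: "norm (C x) \<le> sqrt c * norm x" for x
    using norm_blinfun[of C x] C(2) by (meson mult_right_mono norm_ge_zero order_trans)
  have "norm (X x) \<le> c * norm x" for x
  proof -
    have "norm (X x) * norm (X x) = inner (C (X x)) (C x)"
      by (simp flip: inner_X power2_eq_square power2_norm_eq_inner)
    also have "\<dots> \<le> norm (C (X x)) * norm (C x)" by (rule norm_cauchy_schwarz)
    also have "\<dots> \<le> (sqrt c * norm (X x)) * (sqrt c * norm x)"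
      using Cx c by (intro mult_mono) auto
    also have "\<dots> = norm (X x) * (c * norm x)" using c by (simp add: mult_ac)
    finally show ?thesis using c by (cases "X x = 0") auto
  qed
  then have "norm X \<le> c" using c by (intro norm_blinfun_bound)
  moreover have "inner x (X x) \<le> c * inner x x" for x
  proof -
    have "inner x (X x) = (norm (C x))\<^sup>2" by (simp add: inner_X power2_norm_eq_inner)
    also have "\<dots> \<le> (sqrt c * norm x)\<^sup>2" using Cx by (intro power_mono) auto
    finally show ?thesis using c by (simp add: power_mult_distrib power2_norm_eq_inner)
  qed
  moreover have "X \<in> ops_between (closure (range R)) (closure (range R))"
    unfolding X_def by (rule ops_between_compose[OF C(1) cadjoint_in_ops_between[OF Rb G(1) C(1)]])
  moreover have "symmetric_op X"
    unfolding symmetric_op_def by (metis inner_X inner_commute)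
  moreover have "F = R o\<^sub>L X o\<^sub>L R"
  proof (rule blinfun_eqI, rule inner_eqI)
    fix x z
    have "inner z ((R o\<^sub>L X o\<^sub>L R) x) = inner (R z) (X (R x))" by (simp only: blinfun_apply_blinfun_compose Rsym)
    also have "\<dots> = inner z (F x)" by (simp only: inner_X C(3) G(2,3))
    finally show "inner z (F x) = inner z ((R o\<^sub>L X o\<^sub>L R) x)" ..
  qed
  moreover have "0 \<le> inner x (X x)" for x by (simp add: inner_X)
  ultimately show ?thesis by blast
qed

section \<open>Set functions on the sequence space\<close>

text \<open>The prefix of length \<open>n\<close> of a sequence.\<close>

definition prefix_of :: "nat \<Rightarrow> (nat \<Rightarrow> nat) \<Rightarrow> nat list" where
  "prefix_of n x = map x [0..<n]"

lemma length_prefix_of [simp]: "length (prefix_of n x) = n"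
  by (simp add: prefix_of_def)

lemma prefix_of_eq_iff: "prefix_of n x = w \<longleftrightarrow> length w = n \<and> (\<forall>i<n. x i = w ! i)"
  by (auto simp: prefix_of_def list_eq_iff_nth_eq)

lemma prefix_of_eq_prefix_of: "prefix_of n x = prefix_of n y \<longleftrightarrow> (\<forall>i<n. x i = y i)"
  by (auto simp: prefix_of_def)

lemma prefix_of_Suc: "prefix_of (Suc n) x = prefix_of n x @ [x n]"
  by (simp add: prefix_of_def)

lemma space_Omega: "space (Omega m) = {x. \<forall>i. x i < m}"
  by (auto simp: Omega_def space_PiM)

lemma prefix_of_in_words: "x \<in> space (Omega m) \<Longrightarrow> prefix_of n x \<in> words m"
  by (auto simp: prefix_of_def space_Omega)

lemma cyl_eq: "cyl m w = {x \<in> space (Omega m). prefix_of (length w) x = w}"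
  by (auto simp: cyl_def prefix_of_eq_iff)

lemma cyl_Nil [simp]: "cyl m [] = space (Omega m)"
  by (simp add: cyl_def)

text \<open>The sets that depend on the first \<open>n\<close> coordinates only.\<close>

definition level_set :: "nat \<Rightarrow> nat \<Rightarrow> (nat \<Rightarrow> nat) set \<Rightarrow> bool" where
  "level_set m n A \<longleftrightarrow> A \<subseteq> space (Omega m) \<and>
     (\<forall>x\<in>A. \<forall>y\<in>space (Omega m). prefix_of n x = prefix_of n y \<longrightarrow> y \<in> A)"

lemma level_set_mono: "level_set m n A \<Longrightarrow> n \<le> k \<Longrightarrow> level_set m k A"
  unfolding level_set_def prefix_of_eq_prefix_of by (meson order_less_le_trans)

lemma level_set_cyl: "level_set m (length w) (cyl m w)"
  by (auto simp: level_set_def cyl_eq)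

lemma level_set_Un: "level_set m n A \<Longrightarrow> level_set m n B \<Longrightarrow> level_set m n (A \<union> B)"
  unfolding level_set_def by blast

lemma level_set_compl: "level_set m n A \<Longrightarrow> level_set m n (space (Omega m) - A)"
  unfolding level_set_def by (metis Diff_iff Diff_subset)

lemma finite_prefixes: "A \<subseteq> space (Omega m) \<Longrightarrow> finite (prefix_of n ` A)"
  by (rule finite_subset[OF _ finite_lists_length_eq[of "{..<m}" n]])
     (use prefix_of_in_words in \<open>fastforce simp: in_lists_conv_set\<close>, simp)

lemma prefixes_in_words: "A \<subseteq> space (Omega m) \<Longrightarrow> prefix_of n ` A \<subseteq> words m"
  using prefix_of_in_words by blast

lemma level_set_decomposition: "level_set m n A \<Longrightarrow> A = (\<Union>w\<in>prefix_of n ` A. cyl m w)"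
  unfolding level_set_def cyl_eq by fastforce

lemma cyl_disjoint: "length v = length w \<Longrightarrow> v \<noteq> w \<Longrightarrow> cyl m v \<inter> cyl m w = {}"
  by (auto simp: cyl_eq)

lemma prefixes_disjoint:
  assumes "level_set m n A" "level_set m n B" "A \<inter> B = {}"
  shows "prefix_of n ` A \<inter> prefix_of n ` B = {}"
proof -
  have False if "x \<in> A" "y \<in> B" "prefix_of n x = prefix_of n y" for x y
    using assms that unfolding level_set_def by (metis IntI empty_iff subsetD)
  then show ?thesis by blast
qed

lemma prefixes_Suc:
  assumes "level_set m n A"
  shows "prefix_of (Suc n) ` A = (\<lambda>(w, j). w @ [j]) ` (prefix_of n ` A \<times> {..<m})"
proof (intro equalityI subsetI)
  fix v assume "v \<in> prefix_of (Suc n) ` A"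
  then obtain x where x: "x \<in> A" "v = prefix_of n x @ [x n]" by (auto simp: prefix_of_Suc)
  then have "x n < m" using assms by (auto simp: level_set_def space_Omega)
  then show "v \<in> (\<lambda>(w, j). w @ [j]) ` (prefix_of n ` A \<times> {..<m})" using x by auto
next
  fix v assume "v \<in> (\<lambda>(w, j). w @ [j]) ` (prefix_of n ` A \<times> {..<m})"
  then obtain x j where x: "x \<in> A" "j < m" "v = prefix_of n x @ [j]" by auto
  define y where "y = x(n := j)"
  have "prefix_of n y = prefix_of n x" by (simp add: y_def prefix_of_eq_prefix_of)
  moreover from this have "y \<in> A"
    using x assms unfolding level_set_def by (auto simp: y_def space_Omega)
  ultimately show "v \<in> prefix_of (Suc n) ` A"
    using x by (auto simp: prefix_of_Suc y_def intro!: image_eqI[of _ _ y])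
qed

lemma cyl_in_sets: "cyl m w \<in> sets (Omega m)"
proof -
  have "{x \<in> space (Omega m). x i = a} \<in> sets (Omega m)" for i a
  proof -
    have "(\<lambda>x. x i) \<in> measurable (Omega m) (count_space {..<m})"
      unfolding Omega_def by (rule measurable_component_singleton) simp
    then have "(\<lambda>x. x i) -` ({a} \<inter> {..<m}) \<inter> space (Omega m) \<in> sets (Omega m)"
      by (rule measurable_sets) simp
    also have "(\<lambda>x. x i) -` ({a} \<inter> {..<m}) \<inter> space (Omega m) = {x \<in> space (Omega m). x i = a}"
      by (auto simp: space_Omega)
    finally show ?thesis .
  qed
  then have "{x \<in> space (Omega m). \<forall>i\<in>{..<length w}. x i = w ! i} \<in> sets (Omega m)"
    by (intro sets.sets_Collect_finite_All) auto
  moreover have "cyl m w = {x \<in> space (Omega m). \<forall>i\<in>{..<length w}. x i = w ! i}"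
    unfolding cyl_def by (simp only: Ball_def lessThan_iff)
  ultimately show ?thesis by (simp only:)
qed

lemma level_set_in_sets:
  assumes "level_set m n A"
  shows "A \<in> sets (Omega m)"
proof -
  have "finite (prefix_of n ` A)" using assms by (auto simp: level_set_def intro: finite_prefixes)
  then have "(\<Union>w\<in>prefix_of n ` A. cyl m w) \<in> sets (Omega m)"
    by (intro sets.finite_UN cyl_in_sets)
  then show ?thesis using level_set_decomposition[OF assms] by simp
qed

lemma sets_Omega: "sets (Omega m) = sigma_sets (space (Omega m)) {A. \<exists>n. level_set m n A}"
proof
  let ?G = "{A. \<exists>n. level_set m n A}"
  have "\<exists>n. level_set m n A" if "A = {x \<in> space (Omega m). x i \<in> B}" for A i B
    by (rule exI[of _ "Suc i"]) (auto simp: that level_set_def prefix_of_Suc)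
  then have "{{f \<in> \<Pi>\<^sub>E i\<in>UNIV. space (count_space {..<m}). f i \<in> A} |i A.
       i \<in> UNIV \<and> A \<in> sets (count_space {..<m})} \<subseteq> ?G"
    by (force simp: Omega_def space_PiM)
  then show "sets (Omega m) \<subseteq> sigma_sets (space (Omega m)) ?G"
    unfolding Omega_def sets_PiM_single space_PiM by (rule sigma_sets_mono')
  have "?G \<subseteq> sets (Omega m)" using level_set_in_sets by blast
  then show "sigma_sets (space (Omega m)) ?G \<subseteq> sets (Omega m)" by (rule sets.sigma_sets_subset)
qed

lemma algebra_level_sets: "algebra (space (Omega m)) {A. \<exists>n. level_set m n A}"
proof -
  have "\<exists>n. level_set m n (A \<union> B)" if "level_set m n A" "level_set m k B" for A B n k
    using level_set_Un level_set_mono[OF that(1)] level_set_mono[OF that(2)]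
    by (meson max.cobounded1 max.cobounded2)
  moreover have "level_set m 0 {}" by (simp add: level_set_def)
  moreover have "A \<subseteq> space (Omega m)" if "level_set m n A" for A n
    using that by (simp add: level_set_def)
  ultimately show ?thesis
    unfolding algebra_iff_Un using level_set_compl by blast
qed

text \<open>Real-valued countably additive functions on the measurable sets. Other than measures they form
  a vector space; their values outside the measurable sets are irrelevant.\<close>

definition sigma_additive :: "nat \<Rightarrow> ((nat \<Rightarrow> nat) set \<Rightarrow> real) \<Rightarrow> bool" where
  "sigma_additive m f \<longleftrightarrow> (\<forall>B :: nat \<Rightarrow> (nat \<Rightarrow> nat) set. range B \<subseteq> sets (Omega m) \<longrightarrow>
     disjoint_family B \<longrightarrow> (\<lambda>i. f (B i)) sums f (\<Union>i. B i))"

lemma sigma_additiveD: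
  "sigma_additive m f \<Longrightarrow> range B \<subseteq> sets (Omega m) \<Longrightarrow> disjoint_family B \<Longrightarrow>
    (\<lambda>i. f (B i)) sums f (\<Union>i. B i)"
  by (simp add: sigma_additive_def)

lemma sigma_additive_add: "sigma_additive m f \<Longrightarrow> sigma_additive m g \<Longrightarrow> sigma_additive m (\<lambda>B. f B + g B)"
  by (simp add: sigma_additive_def sums_add)

lemma sigma_additive_diff: "sigma_additive m f \<Longrightarrow> sigma_additive m g \<Longrightarrow> sigma_additive m (\<lambda>B. f B - g B)"
  by (simp add: sigma_additive_def sums_diff)

lemma sigma_additive_mult: "sigma_additive m f \<Longrightarrow> sigma_additive m (\<lambda>B. c * f B)"
  by (simp add: sigma_additive_def sums_mult)

lemma sigma_additive_empty: "sigma_additive m f \<Longrightarrow> f {} = 0"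
  using sigma_additiveD[of m f "\<lambda>_. {}"] sums_unique summable_const_iff
  by (auto simp: disjoint_family_on_def sums_iff)

lemma sigma_additive_Un:
  assumes "sigma_additive m f" "A \<in> sets (Omega m)" "B \<in> sets (Omega m)" "A \<inter> B = {}"
  shows "f (A \<union> B) = f A + f B"
proof -
  have "(\<lambda>i. f (binaryset A B i)) sums f (\<Union>i. binaryset A B i)"
    using assms by (intro sigma_additiveD[OF assms(1)])
      (auto simp: range_binaryset_eq disjoint_family_on_def binaryset_def)
  moreover have "(\<lambda>i. f (binaryset A B i)) sums (f A + f B)"
    by (rule binaryset_sums) (rule sigma_additive_empty[OF assms(1)])
  ultimately show ?thesis using sums_unique2 by (metis UN_binaryset_eq)
qed

lemma sigma_additive_UN:
  assumes "sigma_additive m f" "finite I" "\<And>i. i \<in> I \<Longrightarrow> A i \<in> sets (Omega m)" "disjoint_family_on A I"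
  shows "f (\<Union>i\<in>I. A i) = (\<Sum>i\<in>I. f (A i))"
  using assms(2,3,4)
proof (induction I rule: finite_induct)
  case empty
  then show ?case by (simp add: sigma_additive_empty[OF assms(1)])
next
  case (insert i I)
  have "A i \<inter> (\<Union>i\<in>I. A i) = {}" using insert by (auto simp: disjoint_family_on_def)
  moreover have "(\<Union>i\<in>I. A i) \<in> sets (Omega m)" using insert by (intro sets.finite_UN) auto
  moreover have "disjoint_family_on A I" using insert by (auto simp: disjoint_family_on_def)
  ultimately show ?case using insert sigma_additive_Un[OF assms(1)] by simp
qed

lemma sigma_additive_level_set:
  assumes "sigma_additive m f" "level_set m n A"
  shows "f A = (\<Sum>w\<in>prefix_of n ` A. f (cyl m w))"
proof -
  have "disjoint_family_on (cyl m) (prefix_of n ` A)"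
    by (auto simp: disjoint_family_on_def intro!: cyl_disjoint)
  moreover have "finite (prefix_of n ` A)" using assms by (auto simp: level_set_def intro: finite_prefixes)
  ultimately have "f (\<Union>w\<in>prefix_of n ` A. cyl m w) = (\<Sum>w\<in>prefix_of n ` A. f (cyl m w))"
    using cyl_in_sets by (intro sigma_additive_UN[OF assms(1)])
  then show ?thesis using level_set_decomposition[OF assms(2)] by simp
qed

lemma sigma_additive_cyl:
  assumes "sigma_additive m f" "w \<in> words m"
  shows "f (cyl m w) = (\<Sum>j<m. f (cyl m (w @ [j])))"
proof -
  have "cyl m w = (\<Union>j\<in>{..<m}. cyl m (w @ [j]))"
    by (auto simp: cyl_def space_Omega nth_append less_Suc_eq)
  moreover have "disjoint_family_on (\<lambda>j. cyl m (w @ [j])) {..<m}"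
    by (auto simp: disjoint_family_on_def intro!: cyl_disjoint)
  ultimately show ?thesis
    using sigma_additive_UN[OF assms(1), of "{..<m}" "\<lambda>j. cyl m (w @ [j])"] cyl_in_sets by simp
qed

text \<open>Uniqueness: a countably additive function is determined by its values on cylinders.\<close>

lemma sigma_additive_eqI:
  assumes f: "sigma_additive m f" and g: "sigma_additive m g"
    and eq: "\<And>w. w \<in> words m \<Longrightarrow> f (cyl m w) = g (cyl m w)" and A: "A \<in> sets (Omega m)"
  shows "f A = g A"
proof -
  let ?G = "{A. \<exists>n. level_set m n A}"
  interpret algebra "space (Omega m)" ?G by (rule algebra_level_sets)
  have "Int_stable ?G" by (intro Int_stableI Int)
  moreover have "?G \<subseteq> Pow (space (Omega m))" by (rule space_closed)
  moreover have "A \<in> sigma_sets (space (Omega m)) ?G" using A sets_Omega by blast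
  ultimately show ?thesis
  proof (induction rule: sigma_sets_induct_disjoint)
    case (basic A)
    then obtain n where n: "level_set m n A" by blast
    then have "prefix_of n ` A \<subseteq> words m" by (intro prefixes_in_words) (simp add: level_set_def)
    then show ?case
      unfolding sigma_additive_level_set[OF f n] sigma_additive_level_set[OF g n]
      by (intro sum.cong refl eq) blast
  next
    case empty
    then show ?case using f g by (simp add: sigma_additive_empty)
  next
    case (compl A)
    have "h (space (Omega m) - A) = h (space (Omega m)) - h A" if "sigma_additive m h" for h
    proof -
      have "A \<in> sets (Omega m)" using compl(1) by (simp add: sets_Omega)
      then have "h (A \<union> (space (Omega m) - A)) = h A + h (space (Omega m) - A)"
        by (intro sigma_additive_Un[OF that]) auto
      moreover have "A \<union> (space (Omega m) - A) = space (Omega m)"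
        using \<open>A \<in> sets (Omega m)\<close> sets.sets_into_space by blast
      ultimately show ?thesis by simp
    qed
    from this[OF f] this[OF g] show ?case using compl eq[of "[]"] by simp
  next
    case (union A)
    then have "range A \<subseteq> sets (Omega m)" unfolding sets_Omega by blast
    then have "(\<lambda>i. f (A i)) sums f (\<Union>i. A i)" "(\<lambda>i. g (A i)) sums g (\<Union>i. A i)"
      using union(1) sigma_additiveD[OF f] sigma_additiveD[OF g] by blast+
    moreover have "(\<lambda>i. f (A i)) = (\<lambda>i. g (A i))" using union by blast
    ultimately show ?case using sums_unique2 by metis
  qed
qed

lemma sigma_additive_as_measure:
  assumes f: "sigma_additive m f" and pos: "\<And>B. B \<in> sets (Omega m) \<Longrightarrow> 0 \<le> f B"
  obtains M where "sets M = sets (Omega m)" "finite_measure M"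
    "\<And>B. B \<in> sets (Omega m) \<Longrightarrow> measure M B = f B"
proof -
  define M where "M = measure_of (space (Omega m)) (sets (Omega m)) (\<lambda>B. ennreal (f B))"
  have sets: "sets M = sets (Omega m)" by (simp add: M_def)
  have em: "emeasure M B = ennreal (f B)" if "B \<in> sets (Omega m)" for B
  proof (rule emeasure_measure_of[OF M_def])
    show "positive (sets M) (\<lambda>B. ennreal (f B))"
      by (simp add: positive_def sigma_additive_empty[OF f])
    show "countably_additive (sets M) (\<lambda>B. ennreal (f B))"
    proof (rule countably_additiveI)
      fix B :: "nat \<Rightarrow> (nat \<Rightarrow> nat) set"
      assume B: "range B \<subseteq> sets M" "disjoint_family B"
      then have "(\<lambda>i. f (B i)) sums f (\<Union>i. B i)" using f sets by (auto intro: sigma_additiveD)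
      then show "(\<Sum>i. ennreal (f (B i))) = ennreal (f (\<Union>i. B i))"
        using B pos sets by (auto simp: sums_iff intro!: suminf_ennreal_eq)
    qed
  qed (use that sets sets.space_closed in \<open>auto simp: sets\<close>)
  have "space M = space (Omega m)" using sets by (rule sets_eq_imp_space_eq)
  then have "finite_measure M" by (intro finite_measureI) (simp add: em)
  moreover have "measure M B = f B" if "B \<in> sets (Omega m)" for B
    using em[OF that] pos[OF that] by (simp add: measure_def)
  ultimately show ?thesis using that sets by blast
qed

text \<open>Extension of a consistent family of weights of words that is dominated by a measure.
  The domination yields the continuity at the empty set.\<close>

lemma sigma_additive_extension:
  assumes mu: "sigma_additive m mu" and mu_pos: "\<And>B. B \<in> sets (Omega m) \<Longrightarrow> 0 \<le> mu B"
    and q_pos: "\<And>w. w \<in> words m \<Longrightarrow> 0 \<le> q w"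
    and q_le: "\<And>w. w \<in> words m \<Longrightarrow> q w \<le> mu (cyl m w)"
    and q_sum: "\<And>w. w \<in> words m \<Longrightarrow> q w = (\<Sum>j<m. q (w @ [j]))"
  obtains nu where "sigma_additive m nu" "\<And>B. B \<in> sets (Omega m) \<Longrightarrow> 0 \<le> nu B"
    "\<And>w. w \<in> words m \<Longrightarrow> nu (cyl m w) = q w"
proof -
  \<comment> \<open>the value on a set depending on \<open>n\<close> coordinates; it does not change when \<open>n\<close> is increased\<close>
  define S where "S n A = (\<Sum>w\<in>prefix_of n ` A. q w)" for n A
  define nu0 where "nu0 A = S (LEAST n. level_set m n A) A" for A
  let ?G = "{A. \<exists>n. level_set m n A}"
  interpret algebra "space (Omega m)" ?G by (rule algebra_level_sets)
  have S_Suc: "S (Suc n) A = S n A" if A: "level_set m n A" for n A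
  proof -
    have sp: "A \<subseteq> space (Omega m)" using A by (simp add: level_set_def)
    have "S (Suc n) A = (\<Sum>(w, j)\<in>prefix_of n ` A \<times> {..<m}. q (w @ [j]))"
      unfolding S_def prefixes_Suc[OF A]
      by (subst sum.reindex) (auto simp: inj_on_def o_def case_prod_unfold)
    also have "\<dots> = (\<Sum>w\<in>prefix_of n ` A. \<Sum>j<m. q (w @ [j]))"
      by (rule sum.cartesian_product[symmetric])
    also have "\<dots> = S n A"
      unfolding S_def using prefixes_in_words[OF sp] by (intro sum.cong refl q_sum[symmetric]) blast
    finally show ?thesis .
  qed
  have S_const: "S k A = S n A" if "level_set m n A" "n \<le> k" for n k A
    using that(2) by (induction k rule: dec_induct) (use S_Suc level_set_mono that(1) in metis)+
  have nu0: "nu0 A = S n A" if "level_set m n A" for n A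
    unfolding nu0_def using that by (metis LeastI Least_le S_const)
  have S_pos: "0 \<le> S n A" if "A \<subseteq> space (Omega m)" for n A
    unfolding S_def using prefixes_in_words[OF that] by (intro sum_nonneg q_pos) blast
  have nu0_pos: "0 \<le> nu0 A" if "A \<in> ?G" for A
  proof -
    obtain n where n: "level_set m n A" using \<open>A \<in> ?G\<close> by blast
    then have "A \<subseteq> space (Omega m)" by (simp add: level_set_def)
    then show ?thesis unfolding nu0[OF n] by (rule S_pos)
  qed
  have nu0_le: "nu0 A \<le> mu A" if A: "level_set m n A" for n A
  proof -
    have "A \<subseteq> space (Omega m)" using A by (simp add: level_set_def)
    from prefixes_in_words[OF this] show ?thesis
      unfolding nu0[OF A] S_def sigma_additive_level_set[OF mu A] by (intro sum_mono q_le) blast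
  qed
  have nu0_Un: "nu0 (A \<union> B) = nu0 A + nu0 B" if AB: "level_set m n A" "level_set m k B" "A \<inter> B = {}" for A B n k
  proof -
    define N where "N = max n k"
    have N: "level_set m N A" "level_set m N B" using AB level_set_mono by (auto simp: N_def)
    then have "finite (prefix_of N ` A)" "finite (prefix_of N ` B)"
      by (auto simp: level_set_def intro: finite_prefixes)
    then have "S N (A \<union> B) = S N A + S N B"
      unfolding S_def image_Un using prefixes_disjoint[OF N AB(3)] by (intro sum.union_disjoint)
    then show ?thesis using N level_set_Un nu0 by metis
  qed
  obtain M where M: "sets M = sets (Omega m)" "finite_measure M"
    "\<And>B. B \<in> sets (Omega m) \<Longrightarrow> measure M B = mu B"
    using sigma_additive_as_measure[OF mu mu_pos] by blast
  have "\<exists>\<mu>. (\<forall>s\<in>?G. \<mu> s = ennreal (nu0 s)) \<and> measure_space (space (Omega m)) (sigma_sets (space (Omega m)) ?G) \<mu>"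
  proof (rule caratheodory_empty_continuous)
    have "nu0 {} = 0" using nu0[of 0 "{}"] by (simp add: level_set_def S_def)
    then show "positive ?G (\<lambda>s. ennreal (nu0 s))" by (simp add: positive_def)
    show "additive ?G (\<lambda>s. ennreal (nu0 s))"
      unfolding additive_def using nu0_Un nu0_pos by (auto simp flip: ennreal_plus)
    show "ennreal (nu0 A) \<noteq> \<infinity>" for A by simp
    fix A :: "nat \<Rightarrow> (nat \<Rightarrow> nat) set"
    assume A: "range A \<subseteq> ?G" "decseq A" "(\<Inter>i. A i) = {}"
    have As: "range A \<subseteq> sets M" using A(1) level_set_in_sets M(1) by blast
    have "(\<lambda>i. measure M (A i)) \<longlonglongrightarrow> measure M (\<Inter>i. A i)"
      by (rule finite_measure.finite_Lim_measure_decseq[OF M(2) As A(2)])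
    then have "(\<lambda>i. mu (A i)) \<longlonglongrightarrow> 0" using M As A(3) by (auto simp: range_subsetD)
    then have "(\<lambda>i. nu0 (A i)) \<longlonglongrightarrow> 0"
      by (rule tendsto_sandwich[OF _ _ tendsto_const, rotated 2])
         (use A(1) nu0_pos nu0_le in \<open>auto intro!: always_eventually\<close>)
    then show "(\<lambda>i. ennreal (nu0 (A i))) \<longlonglongrightarrow> 0" using tendsto_ennrealI by fastforce
  qed
  then obtain \<mu> where \<mu>: "\<And>s. s \<in> ?G \<Longrightarrow> \<mu> s = ennreal (nu0 s)"
    "measure_space (space (Omega m)) (sets (Omega m)) \<mu>"
    by (auto simp: sets_Omega)
  define N where "N = measure_of (space (Omega m)) (sets (Omega m)) \<mu>"
  have N: "sets N = sets (Omega m)" by (simp add: N_def)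
  have em: "emeasure N B = \<mu> B" if "B \<in> sets (Omega m)" for B
    using \<mu>(2) that sets.space_closed unfolding measure_space_def
    by (intro emeasure_measure_of[OF N_def]) (auto simp: N)
  have N_cyl: "measure N (cyl m w) = q w" if "w \<in> words m" for w
  proof -
    have lv: "level_set m (length w) (cyl m w)" by (rule level_set_cyl)
    have "emeasure N (cyl m w) = ennreal (nu0 (cyl m w))" using em[OF cyl_in_sets] \<mu>(1) lv by auto
    moreover have "nu0 (cyl m w) = q w"
    proof (cases "cyl m w = {}")
      case False
      then have "prefix_of (length w) ` cyl m w = {w}" by (auto simp: cyl_eq)
      then show ?thesis using nu0[OF lv] by (simp add: S_def)
    next
      case True
      then have "q w = 0" using q_pos[OF that] q_le[OF that] sigma_additive_empty[OF mu] by simp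
      then show ?thesis using nu0[OF lv] True by (simp add: S_def)
    qed
    ultimately show ?thesis using q_pos[OF that] by (simp add: measure_def)
  qed
  have "space (Omega m) \<in> ?G" by (rule top)
  moreover have "space N = space (Omega m)" using N by (rule sets_eq_imp_space_eq)
  ultimately have fin: "finite_measure N" using em \<mu>(1) by (intro finite_measureI) simp
  show ?thesis
  proof (rule that)
    show "sigma_additive m (measure N)"
      unfolding sigma_additive_def N[symmetric] using finite_measure.finite_measure_UNION[OF fin] by blast
  qed (use N_cyl in auto)
qed

text \<open>The extension is again dominated by \<open>mu\<close>.\<close>

lemma sigma_additive_extension_le:
  assumes mu: "sigma_additive m mu" and mu_pos: "\<And>B. B \<in> sets (Omega m) \<Longrightarrow> 0 \<le> mu B"
    and q_pos: "\<And>w. w \<in> words m \<Longrightarrow> 0 \<le> q w"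
    and q_le: "\<And>w. w \<in> words m \<Longrightarrow> q w \<le> mu (cyl m w)"
    and q_sum: "\<And>w. w \<in> words m \<Longrightarrow> q w = (\<Sum>j<m. q (w @ [j]))"
  shows "\<exists>nu. sigma_additive m nu \<and> (\<forall>B\<in>sets (Omega m). 0 \<le> nu B \<and> nu B \<le> mu B) \<and>
    (\<forall>w\<in>words m. nu (cyl m w) = q w)"
proof -
  obtain nu where nu: "sigma_additive m nu" "\<And>B. B \<in> sets (Omega m) \<Longrightarrow> 0 \<le> nu B"
    "\<And>w. w \<in> words m \<Longrightarrow> nu (cyl m w) = q w"
    using sigma_additive_extension[OF assms] by blast
  \<comment> \<open>the weights \<open>mu - q\<close> extend as well, to the measure \<open>mu - nu\<close>, which is thus positive\<close>
  have "mu (cyl m w) - q w = (\<Sum>j<m. mu (cyl m (w @ [j])) - q (w @ [j]))" if "w \<in> words m" for w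
    using sigma_additive_cyl[OF mu that] q_sum[OF that] by (simp add: sum_subtractf)
  moreover have "0 \<le> mu (cyl m w) - q w" "mu (cyl m w) - q w \<le> mu (cyl m w)" if "w \<in> words m" for w
    using q_pos[OF that] q_le[OF that] by auto
  ultimately obtain nu' where nu': "sigma_additive m nu'"
    "\<And>B. B \<in> sets (Omega m) \<Longrightarrow> 0 \<le> nu' B"
    "\<And>w. w \<in> words m \<Longrightarrow> nu' (cyl m w) = mu (cyl m w) - q w"
    using sigma_additive_extension[OF mu mu_pos, of "\<lambda>w. mu (cyl m w) - q w"] by blast
  have "nu B + nu' B = mu B" if "B \<in> sets (Omega m)" for B
    by (rule sigma_additive_eqI[OF sigma_additive_add[OF nu(1) nu'(1)] mu _ that]) (simp add: nu nu')
  then have "nu B \<le> mu B" if "B \<in> sets (Omega m)" for B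
    using nu'(2)[OF that] that by force
  then show ?thesis using nu by blast
qed

section \<open>Positive operator-valued measures\<close>

lemma pos_op_measures_positive:
  "F \<in> pos_op_measures m \<Longrightarrow> B \<in> sets (Omega m) \<Longrightarrow> F B \<in> positive_ops"
  by (auto simp: pos_op_measures_def)

lemma pos_op_measures_sigma_additive:
  assumes "F \<in> pos_op_measures m"
  shows "sigma_additive m (\<lambda>B. inner x (F B y))"
  using assms by (auto simp: sigma_additive_def pos_op_measures_def inner_eq_Re_cinner intro!: sums_Re)

lemma pos_op_measuresI:
  assumes "F \<in> extensional (sets (Omega m))" "\<And>B. B \<in> sets (Omega m) \<Longrightarrow> F B \<in> positive_ops"
    and "\<And>x y. sigma_additive m (\<lambda>B. inner x (F B y))"
  shows "F \<in> pos_op_measures m"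
proof -
  have "(\<lambda>i. cinner x (F (B i) y)) sums cinner x (F (\<Union>i. B i) y)"
    if "range B \<subseteq> sets (Omega m)" "disjoint_family B" for B x y
    unfolding sums_complex_iff cinner_eq_Complex complex.sel
    using sigma_additiveD[OF assms(3) that] by blast
  then show ?thesis using assms(1,2) by (auto simp: pos_op_measures_def PiE_def)
qed

lemma pos_op_measures_eqI:
  assumes F: "F \<in> pos_op_measures m" and G: "G \<in> pos_op_measures m"
    and eq: "\<And>w. w \<in> words m \<Longrightarrow> F (cyl m w) = G (cyl m w)"
  shows "F = G"
proof (rule PiE_ext)
  show "F \<in> sets (Omega m) \<rightarrow>\<^sub>E positive_ops" "G \<in> sets (Omega m) \<rightarrow>\<^sub>E positive_ops"
    using F G by (auto simp: pos_op_measures_def)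
  fix B assume B: "B \<in> sets (Omega m)"
  have "inner x (F B y) = inner x (G B y)" for x y
    by (rule sigma_additive_eqI[OF pos_op_measures_sigma_additive[OF F]
          pos_op_measures_sigma_additive[OF G] _ B]) (simp add: eq)
  then show "F B = G B" by (auto intro!: blinfun_eqI inner_eqI[where 'a = 'a])
qed

lemma pos_op_measures_mono:
  assumes F: "F \<in> pos_op_measures m" and B: "B \<in> sets (Omega m)" "B' \<in> sets (Omega m)" "B \<subseteq> B'"
  shows "inner x (F B x) \<le> inner x (F B' x)"
proof -
  have "inner x (F (B \<union> (B' - B)) x) = inner x (F B x) + inner x (F (B' - B) x)"
    using B by (intro sigma_additive_Un[OF pos_op_measures_sigma_additive[OF F]]) auto
  moreover have "0 \<le> inner x (F (B' - B) x)"
    using pos_op_measures_positive[OF F, of "B' - B"] B by (auto simp: positive_ops_iff psd_op_def)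
  moreover have "B \<union> (B' - B) = B'" using B by blast
  ultimately show ?thesis by simp
qed

lemma psd_op_scaleR: "psd_op T \<Longrightarrow> 0 \<le> r \<Longrightarrow> psd_op (r *\<^sub>R T)"
  by (simp add: psd_op_def symmetric_op_def blinfun.scaleR_left)

lemma dominated_measures_iff:
  assumes E: "E \<in> pos_op_measures m" and c: "0 \<le> c"
  shows "F \<in> dominated_measures m c E \<longleftrightarrow> F \<in> pos_op_measures m \<and>
    (\<forall>B\<in>sets (Omega m). \<forall>x. inner x (F B x) \<le> c * inner x (E B x))"
proof (intro iffI conjI ballI allI)
  fix B x assume F: "F \<in> dominated_measures m c E" and B: "B \<in> sets (Omega m)"
  then have "op_le_on UNIV (F B) (c *\<^sub>R E B)" by (simp add: dominated_measures_def)
  from op_le_onD[OF this, of x] show "inner x (F B x) \<le> c * inner x (E B x)"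
    by (simp add: blinfun.scaleR_left)
next
  assume F: "F \<in> pos_op_measures m \<and>
    (\<forall>B\<in>sets (Omega m). \<forall>x. inner x (F B x) \<le> c * inner x (E B x))"
  have "op_le_on UNIV 0 (F B) \<and> op_le_on UNIV (F B) (c *\<^sub>R E B)" if B: "B \<in> sets (Omega m)" for B
  proof
    have FB: "F B \<in> positive_ops" and EB: "E B \<in> positive_ops"
      using F E B pos_op_measures_positive by auto
    then show "op_le_on UNIV 0 (F B)" by (simp add: positive_ops_def)
    have "psd_op (c *\<^sub>R E B)" using EB c by (simp add: psd_op_scaleR positive_ops_iff)
    then show "op_le_on UNIV (F B) (c *\<^sub>R E B)"
      using FB EB F B by (intro op_le_onI)
        (auto simp: positive_ops_iff psd_op_def scaleR_in_bounded_ops blinfun.scaleR_left)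
  qed
  then show "F \<in> dominated_measures m c E" using F by (simp add: dominated_measures_def)
qed (simp add: dominated_measures_def)

text \<open>Extension of a dominated, consistent family of positive operators. The scalar measures
  \<open>nu x\<close> extend the quadratic forms of the given operators, and polarization in \<open>x\<close> gives bounded
  bilinear forms; every identity between these forms is checked on cylinders.\<close>

lemma dominated_measure_extension:
  fixes E :: "'a::chilbert_space op_measure"
  assumes E: "E \<in> pos_op_measures m" and c: "0 \<le> c"
    and T: "\<And>w. w \<in> words m \<Longrightarrow> T w \<in> positive_ops"
    and T_le: "\<And>w x. w \<in> words m \<Longrightarrow> inner x (T w x) \<le> c * inner x (E (cyl m w) x)"
    and T_sum: "\<And>w. w \<in> words m \<Longrightarrow> T w = (\<Sum>j<m. T (w @ [j]))"
  shows "\<exists>F\<in>dominated_measures m c E. \<forall>w\<in>words m. F (cyl m w) = T w"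
proof -
  have Tsym: "inner x (T w y) = inner y (T w x)" and Tpos: "0 \<le> inner x (T w x)"
    and Ti: "T w (\<i> *\<^sub>C x) = \<i> *\<^sub>C T w x" if "w \<in> words m" for w x y
    using T[OF that] by (auto simp: positive_ops_iff psd_op_def symmetric_op_def bounded_ops_iff inner_commute)
  have "\<exists>nu. sigma_additive m nu \<and> (\<forall>B\<in>sets (Omega m). 0 \<le> nu B \<and> nu B \<le> c * inner x (E B x)) \<and>
    (\<forall>w\<in>words m. nu (cyl m w) = inner x (T w x))" for x
  proof (rule sigma_additive_extension_le)
    show "sigma_additive m (\<lambda>B. c * inner x (E B x))"
      by (intro sigma_additive_mult pos_op_measures_sigma_additive E)
    show "0 \<le> c * inner x (E B x)" if "B \<in> sets (Omega m)" for B
      using pos_op_measures_positive[OF E that] c by (simp add: positive_ops_iff psd_op_def)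
    show "inner x (T w x) = (\<Sum>j<m. inner x (T (w @ [j]) x))" if "w \<in> words m" for w
      by (subst T_sum[OF that]) (simp add: blinfun.sum_left inner_sum_right)
  qed (use Tpos T_le in auto)
  then obtain nu where nu_sa: "\<And>x. sigma_additive m (nu x)"
    and nu_pos: "\<And>x B. B \<in> sets (Omega m) \<Longrightarrow> 0 \<le> nu x B"
    and nu_le: "\<And>x B. B \<in> sets (Omega m) \<Longrightarrow> nu x B \<le> c * inner x (E B x)"
    and nu_cyl: "\<And>x w. w \<in> words m \<Longrightarrow> nu x (cyl m w) = inner x (T w x)"
    by metis
  \<comment> \<open>real polarization suffices, since \<open>T w\<close> is symmetric for the real inner product\<close>
  define b where "b B x y = (1/4) * (nu (x + y) B - nu (x - y) B)" for B x y
  have b_sa: "sigma_additive m (\<lambda>B. b B x y)" for x y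
    unfolding b_def by (intro sigma_additive_mult sigma_additive_diff nu_sa)
  have b_cyl: "b (cyl m w) x y = inner x (T w y)" if w: "w \<in> words m" for w x y
    unfolding b_def nu_cyl[OF w]
    by (simp add: blinfun.add_right blinfun.diff_right inner_add_left inner_add_right
        inner_diff_left inner_diff_right Tsym[OF w, of y x])
  note b_eqI = sigma_additive_eqI[where m = m]
  have b_sym: "b B x y = b B y x" if "B \<in> sets (Omega m)" for B x y
    by (rule b_eqI[OF b_sa b_sa _ that]) (simp add: b_cyl Tsym)
  have b_add: "b B x (y + z) = b B x y + b B x z" if "B \<in> sets (Omega m)" for B x y z
    by (rule b_eqI[OF b_sa sigma_additive_add[OF b_sa b_sa] _ that])
       (simp add: b_cyl blinfun.add_right inner_add_right)
  have b_scale: "b B x (r *\<^sub>R y) = r * b B x y" if "B \<in> sets (Omega m)" for B x y r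
    by (rule b_eqI[OF b_sa sigma_additive_mult[OF b_sa] _ that])
       (simp add: b_cyl blinfun.scaleR_right)
  have b_i: "b B x (\<i> *\<^sub>C y) = (-1) * b B (\<i> *\<^sub>C x) y" if "B \<in> sets (Omega m)" for B x y
    by (rule b_eqI[OF b_sa sigma_additive_mult[OF b_sa] _ that])
       (simp add: b_cyl Ti inner_scaleC_i_left)
  have b_diag: "b B x x = nu x B" if "B \<in> sets (Omega m)" for B x
    by (rule b_eqI[OF b_sa nu_sa _ that]) (simp add: b_cyl nu_cyl)
  define K where "K = c * norm (E (space (Omega m)))"
  have nu_bound: "nu x B \<le> K * (norm x)\<^sup>2" if B: "B \<in> sets (Omega m)" for x B
  proof -
    let ?E = "E (space (Omega m))"
    have "inner x (E B x) \<le> inner x (?E x)"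
      using B sets.sets_into_space[OF B] by (intro pos_op_measures_mono[OF E]) auto
    also have "\<dots> \<le> norm x * norm (?E x)" by (rule norm_cauchy_schwarz)
    also have "\<dots> \<le> norm x * (norm ?E * norm x)" by (intro mult_left_mono norm_blinfun) auto
    finally have "c * inner x (E B x) \<le> c * (norm x * (norm ?E * norm x))" using c by (rule mult_left_mono)
    then show ?thesis using nu_le[OF B, of x] by (simp add: K_def power2_eq_square mult_ac)
  qed
  have b_bound: "\<bar>b B x y\<bar> \<le> norm x * norm y * K" if B: "B \<in> sets (Omega m)" for B x y
  proof -
    \<comment> \<open>the parallelogram law bounds \<open>b\<close> on unit vectors, and bilinearity extends the bound\<close>
    have unit: "\<bar>b B u v\<bar> \<le> K" if "norm u = 1" "norm v = 1" for u v
    proof -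
      have "K * ((norm (u + v))\<^sup>2 + (norm (u - v))\<^sup>2) = 4 * K"
        by (simp add: parallelogram that)
      then have "nu (u + v) B + nu (u - v) B \<le> 4 * K"
        using nu_bound[OF B, of "u + v"] nu_bound[OF B, of "u - v"] by (simp add: algebra_simps)
      then show ?thesis using nu_pos[OF B, of "u + v"] nu_pos[OF B, of "u - v"] by (simp add: b_def)
    qed
    show ?thesis
    proof (cases "x = 0 \<or> y = 0")
      case True
      then have "b B x y = 0" using b_scale[OF B, of _ 0] b_sym[OF B, of x y] by auto
      then show ?thesis using True by auto
    next
      case False
      define u v where "u = x /\<^sub>R norm x" and "v = y /\<^sub>R norm y"
      have x: "x = norm x *\<^sub>R u" and y: "y = norm y *\<^sub>R v" using False by (auto simp: u_def v_def)
      have "b B x y = norm y * b B x v" by (subst y) (rule b_scale[OF B])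
      also have "b B x v = b B v x" by (rule b_sym[OF B])
      also have "b B v x = norm x * b B v u" by (subst x) (rule b_scale[OF B])
      finally have "\<bar>b B x y\<bar> = norm x * norm y * \<bar>b B v u\<bar>" by (simp add: abs_mult)
      also have "\<dots> \<le> norm x * norm y * K"
        using unit[of v u] False by (intro mult_left_mono) (auto simp: u_def v_def)
      finally show ?thesis .
    qed
  qed
  have "\<exists>S :: 'a \<Rightarrow>\<^sub>L 'a. \<forall>x y. b B x y = inner x (S y)" if B: "B \<in> sets (Omega m)" for B
  proof -
    have "bounded_bilinear (b B)"
    proof (rule bounded_bilinear.intro)
      show "b B (a + a') y = b B a y + b B a' y" for a a' y
        using b_add[OF B, of y a a'] by (simp add: b_sym[OF B, of y])
      show "b B (r *\<^sub>R a) y = r *\<^sub>R b B a y" for r a y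
        using b_scale[OF B, of y r a] by (simp add: b_sym[OF B, of y])
      show "\<exists>K. \<forall>x y. norm (b B x y) \<le> norm x * norm y * K" using b_bound[OF B] by auto
    qed (simp_all add: b_add[OF B] b_scale[OF B])
    from bounded_bilinear_representation[OF this] show ?thesis by blast
  qed
  then obtain S :: "(nat \<Rightarrow> nat) set \<Rightarrow> 'a \<Rightarrow>\<^sub>L 'a"
    where S: "\<And>B x y. B \<in> sets (Omega m) \<Longrightarrow> inner x (S B y) = b B x y"
    by metis
  define F where "F = restrict S (sets (Omega m))"
  have F: "inner x (F B y) = b B x y" if "B \<in> sets (Omega m)" for B x y
    using S[OF that] that by (simp add: F_def)
  have F_cyl: "F (cyl m w) = T w" if "w \<in> words m" for w
  proof (rule blinfun_eqI, rule inner_eqI)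
    show "inner x (F (cyl m w) y) = inner x (T w y)" for x y
      by (simp add: F[OF cyl_in_sets] b_cyl[OF that])
  qed
  have F_pos: "F B \<in> positive_ops" if B: "B \<in> sets (Omega m)" for B
  proof -
    have "F B (\<i> *\<^sub>C y) = \<i> *\<^sub>C F B y" for y
    proof (rule inner_eqI)
      fix x
      have "inner x (F B (\<i> *\<^sub>C y)) = - inner (\<i> *\<^sub>C x) (F B y)" by (simp add: F[OF B] b_i[OF B])
      then show "inner x (F B (\<i> *\<^sub>C y)) = inner x (\<i> *\<^sub>C F B y)" by (simp add: inner_scaleC_i_left)
    qed
    moreover have "inner (F B x) y = inner x (F B y)" for x y
      by (subst inner_commute) (simp only: F[OF B] b_sym[OF B, of y x])
    moreover have "0 \<le> inner x (F B x)" for x by (simp add: F[OF B] b_diag[OF B] nu_pos[OF B])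
    ultimately show ?thesis
      by (simp add: positive_ops_iff bounded_ops_iff psd_op_def symmetric_op_def)
  qed
  have "F \<in> pos_op_measures m"
  proof (rule pos_op_measuresI)
    show "sigma_additive m (\<lambda>B. inner x (F B y))" for x y
      unfolding sigma_additive_def
    proof (intro allI impI)
      fix B :: "nat \<Rightarrow> (nat \<Rightarrow> nat) set"
      assume B: "range B \<subseteq> sets (Omega m)" "disjoint_family B"
      then have "B i \<in> sets (Omega m)" for i by blast
      moreover from this have "(\<Union>i. B i) \<in> sets (Omega m)" by blast
      ultimately show "(\<lambda>i. inner x (F (B i) y)) sums inner x (F (\<Union>i. B i) y)"
        using sigma_additiveD[OF b_sa B] by (simp add: F)
    qed
  qed (use F_pos in \<open>auto simp: F_def\<close>)
  moreover have "inner x (F B x) \<le> c * inner x (E B x)" if "B \<in> sets (Omega m)" for B x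
    using nu_le[OF that] by (simp add: F[OF that] b_diag[OF that])
  ultimately have "F \<in> dominated_measures m c E" by (simp add: dominated_measures_iff[OF E c])
  then show ?thesis using F_cyl by blast
qed

section \<open>Range martingales\<close>

lemma sqrt_at:
  assumes "E \<in> pos_op_measures m"
  shows sqrt_at_positive: "sqrt_at m E w \<in> positive_ops"
    and sqrt_at_square: "sqrt_at m E w (sqrt_at m E w x) = E (cyl m w) x"
proof -
  have E: "E (cyl m w) \<in> positive_ops" by (rule pos_op_measures_positive[OF assms cyl_in_sets])
  show "sqrt_at m E w \<in> positive_ops" unfolding sqrt_at_def by (rule op_sqrt_positive[OF E])
  show "sqrt_at m E w (sqrt_at m E w x) = E (cyl m w) x"
    unfolding sqrt_at_def using op_sqrt_square[OF E] by (metis blinfun_apply_blinfun_compose)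
qed

lemma sqrt_at_bounded_op: "E \<in> pos_op_measures m \<Longrightarrow> sqrt_at m E w \<in> bounded_ops"
  using sqrt_at_positive positive_ops_iff by blast

lemma inner_sqrt_at:
  "E \<in> pos_op_measures m \<Longrightarrow> inner x (sqrt_at m E w y) = inner (sqrt_at m E w x) y"
  using sqrt_at_positive[of E m w] by (simp add: positive_ops_iff psd_op_def symmetric_op_def)

lemma norm_sqrt_at:
  assumes "E \<in> pos_op_measures m"
  shows "(norm (sqrt_at m E w x))\<^sup>2 = inner x (E (cyl m w) x)"
  unfolding power2_norm_eq_inner by (simp flip: sqrt_at_square[OF assms] add: inner_sqrt_at[OF assms])

lemma edge_contraction:
  assumes E: "E \<in> pos_op_measures m"
  shows edge_contraction_between:
      "edge_contraction m E w j \<in> ops_between (range_space m E w) (range_space m E (w @ [j]))"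
    and edge_contraction_sqrt_at:
      "edge_contraction m E w j (sqrt_at m E w h) = sqrt_at m E (w @ [j]) h"
proof -
  let ?P = "\<lambda>C. C \<in> ops_between (range_space m E w) (range_space m E (w @ [j])) \<and> norm C \<le> 1 \<and>
        (\<forall>h. C (sqrt_at m E w h) = sqrt_at m E (w @ [j]) h)"
  have "norm (sqrt_at m E (w @ [j]) h) \<le> 1 * norm (sqrt_at m E w h)" for h
  proof -
    have "cyl m (w @ [j]) \<subseteq> cyl m w" by (auto simp: cyl_def nth_append)
    then have "(norm (sqrt_at m E (w @ [j]) h))\<^sup>2 \<le> (norm (sqrt_at m E w h))\<^sup>2"
      unfolding norm_sqrt_at[OF E] by (intro pos_op_measures_mono[OF E] cyl_in_sets)
    then show ?thesis by (simp add: power2_le_iff_abs_le)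
  qed
  from douglas_ops_between[OF sqrt_at_bounded_op[OF E] sqrt_at_bounded_op[OF E] zero_le_one this]
  obtain C where "?P C" unfolding range_space_def by blast
  moreover have "C' = C''" if "?P C'" "?P C''" for C' C''
    using that ops_between_eqI[OF sqrt_at_bounded_op[OF E]] unfolding range_space_def by metis
  ultimately have "?P (edge_contraction m E w j)"
    unfolding edge_contraction_def by (intro theI'[of ?P]) blast
  then show "edge_contraction m E w j \<in> ops_between (range_space m E w) (range_space m E (w @ [j]))"
    "edge_contraction m E w j (sqrt_at m E w h) = sqrt_at m E (w @ [j]) h" by blast+
qed

lemma edge_contraction_bounded_op: "E \<in> pos_op_measures m \<Longrightarrow> edge_contraction m E w j \<in> bounded_ops"
  using edge_contraction_between[of E m w j] by (simp add: ops_between_def)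

text \<open>The edge contractions turn \<open>E\<^sub>w\<^bsup>1/2\<^esup>\<close> into \<open>E\<^sub>w\<^sub>j\<^bsup>1/2\<^esup>\<close>, so the compression of the martingale sum is
  the sum of the compressions for the extended words.\<close>

lemma compression_martingale_sum:
  assumes E: "E \<in> pos_op_measures m"
  shows "sqrt_at m E w o\<^sub>L
      (\<Sum>j<m. cadjoint (edge_contraction m E w j) o\<^sub>L Y j o\<^sub>L edge_contraction m E w j) o\<^sub>L
      sqrt_at m E w = (\<Sum>j<m. sqrt_at m E (w @ [j]) o\<^sub>L Y j o\<^sub>L sqrt_at m E (w @ [j]))"
proof (rule blinfun_eqI, rule inner_eqI)
  fix x z
  show "inner z ((sqrt_at m E w o\<^sub>L
      (\<Sum>j<m. cadjoint (edge_contraction m E w j) o\<^sub>L Y j o\<^sub>L edge_contraction m E w j) o\<^sub>L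
      sqrt_at m E w) x) = inner z ((\<Sum>j<m. sqrt_at m E (w @ [j]) o\<^sub>L Y j o\<^sub>L sqrt_at m E (w @ [j])) x)"
    by (simp add: blinfun.sum_left inner_sum_right inner_sqrt_at[OF E] edge_contraction_sqrt_at[OF E]
        inner_cadjoint[OF edge_contraction_bounded_op[OF E], symmetric])
qed

text \<open>Dominated martingales in terms of the real inner product.\<close>

lemma dominated_martingales_iff:
  fixes E :: "'a::chilbert_space op_measure"
  shows "X \<in> dominated_martingales m c E \<longleftrightarrow>
    X \<in> (\<Pi>\<^sub>E w\<in>words m. ops_between (range_space m E w) (range_space m E w)) \<and>
    bdd_above ((\<lambda>w. norm (X w)) ` words m) \<and>
    (\<forall>w\<in>words m. symmetric_op (X w) \<and>
      X w = (\<Sum>j<m. cadjoint (edge_contraction m E w j) o\<^sub>L X (w @ [j]) o\<^sub>L edge_contraction m E w j) \<and>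
      (\<forall>x\<in>range_space m E w. 0 \<le> inner x (X w x) \<and> inner x (X w x) \<le> c * inner x x))"
    (is "?L \<longleftrightarrow> ?R")
proof -
  let ?M = "\<Pi>\<^sub>E w\<in>words m. ops_between (range_space m E w) (range_space m E w)"
  let ?bdd = "bdd_above ((\<lambda>w. norm (X w)) ` words m)"
  let ?eq = "\<lambda>w. X w =
    (\<Sum>j<m. cadjoint (edge_contraction m E w j) o\<^sub>L X (w @ [j]) o\<^sub>L edge_contraction m E w j)"
  let ?le = "\<lambda>w. op_le_on (range_space m E w) 0 (X w) \<and>
    op_le_on (range_space m E w) (X w) (c *\<^sub>R id_blinfun)"
  have "?L \<longleftrightarrow> X \<in> ?M \<and> ?bdd \<and> (\<forall>w\<in>words m. cadjoint (X w) = X w \<and> ?eq w \<and> ?le w)"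
    unfolding dominated_martingales_def positive_range_martingales_def bounded_range_martingales_def
      mem_Collect_eq ball_conj_distrib by (rule iffI; elim conjE; intro conjI; assumption)
  also have "\<dots> \<longleftrightarrow> ?R"
  proof (intro conj_cong refl ball_cong)
    fix w assume "X \<in> ?M" and w: "w \<in> words m"
    then have b: "X w \<in> bounded_ops" using PiE_mem[OF _ w] by (fastforce simp: ops_between_def)
    show "cadjoint (X w) = X w \<longleftrightarrow> symmetric_op (X w)" by (rule cadjoint_eq_self_iff[OF b])
    assume sym: "symmetric_op (X w)"
    show "?le w \<longleftrightarrow> (\<forall>x\<in>range_space m E w. 0 \<le> inner x (X w x) \<and> inner x (X w x) \<le> c * inner x x)"
    proof
      assume le: "?le w"
      show "\<forall>x\<in>range_space m E w. 0 \<le> inner x (X w x) \<and> inner x (X w x) \<le> c * inner x x"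
        using op_le_onD[OF le[THEN conjunct1]] op_le_onD[OF le[THEN conjunct2]]
        by (simp add: blinfun.scaleR_left)
    next
      assume le: "\<forall>x\<in>range_space m E w. 0 \<le> inner x (X w x) \<and> inner x (X w x) \<le> c * inner x x"
      have "symmetric_op (c *\<^sub>R id_blinfun :: 'a \<Rightarrow>\<^sub>L 'a)"
        by (simp add: symmetric_op_def blinfun.scaleR_left)
      then show "?le w"
        using le by (intro conjI op_le_onI b sym scaleR_in_bounded_ops) (simp_all add: blinfun.scaleR_left)
    qed
  qed
  finally show ?thesis .
qed

lemma martingale_of_dominated_measure:
  fixes E :: "'a::chilbert_space op_measure"
  assumes E: "E \<in> pos_op_measures m" and c: "0 \<le> c" and F: "F \<in> dominated_measures m c E"
  shows "\<exists>X\<in>dominated_martingales m c E.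
    \<forall>w\<in>words m. F (cyl m w) = sqrt_at m E w o\<^sub>L X w o\<^sub>L sqrt_at m E w"
proof -
  have F': "F \<in> pos_op_measures m"
    "\<And>B x. B \<in> sets (Omega m) \<Longrightarrow> inner x (F B x) \<le> c * inner x (E B x)"
    using F by (auto simp: dominated_measures_iff[OF E c])
  let ?P = "\<lambda>w X. X \<in> ops_between (range_space m E w) (range_space m E w) \<and> symmetric_op X \<and>
    norm X \<le> c \<and> (\<forall>x. 0 \<le> inner x (X x) \<and> inner x (X x) \<le> c * inner x x) \<and>
    F (cyl m w) = sqrt_at m E w o\<^sub>L X o\<^sub>L sqrt_at m E w"
  have "\<exists>X. ?P w X" for w
  proof -
    have "inner h (F (cyl m w) h) \<le> c * (norm (sqrt_at m E w h))\<^sup>2" for h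
      using F'(2)[OF cyl_in_sets] by (simp add: norm_sqrt_at[OF E])
    then show ?thesis
      unfolding range_space_def
      by (rule compression_exists[OF sqrt_at_positive[OF E] pos_op_measures_positive[OF F'(1) cyl_in_sets] c])
  qed
  then have "\<forall>w. \<exists>X. ?P w X" by blast
  then obtain Y where "\<forall>w. ?P w (Y w)" by (rule choice[THEN exE])
  then have Y: "?P w (Y w)" for w by blast
  define X where "X = restrict Y (words m)"
  have X: "X w = Y w" if "w \<in> words m" for w using that by (simp add: X_def)
  have mart: "Y w = (\<Sum>j<m. cadjoint (edge_contraction m E w j) o\<^sub>L Y (w @ [j]) o\<^sub>L edge_contraction m E w j)"
    (is "_ = ?S") if w: "w \<in> words m" for w
  proof (rule compression_inj[OF sqrt_at_positive[OF E]])
    show "Y w \<in> ops_between (closure (range (sqrt_at m E w))) (closure (range (sqrt_at m E w)))"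
      using Y[of w] by (simp add: range_space_def)
    have "cadjoint (edge_contraction m E w j) o\<^sub>L Y (w @ [j]) o\<^sub>L edge_contraction m E w j
        \<in> ops_between (range_space m E w) (range_space m E w)" for j
    proof -
      note C = edge_contraction_between[OF E, of w j]
      from C have "cadjoint (edge_contraction m E w j)
          \<in> ops_between (range_space m E (w @ [j])) (range_space m E w)"
        unfolding range_space_def by (rule cadjoint_in_ops_between[OF sqrt_at_bounded_op[OF E] sqrt_at_bounded_op[OF E]])
      then show ?thesis using Y[of "w @ [j]"] C ops_between_compose by blast
    qed
    then show "?S \<in> ops_between (closure (range (sqrt_at m E w))) (closure (range (sqrt_at m E w)))"
      unfolding range_space_def by (intro ops_between_sum subspace_closure_range_blinfun) auto
    have "F (cyl m w) x = (\<Sum>j<m. F (cyl m (w @ [j])) x)" for x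
    proof (rule inner_eqI)
      show "inner z (F (cyl m w) x) = inner z (\<Sum>j<m. F (cyl m (w @ [j])) x)" for z
        using sigma_additive_cyl[OF pos_op_measures_sigma_additive[OF F'(1)] w] by (simp add: inner_sum_right)
    qed
    then have "F (cyl m w) = (\<Sum>j<m. F (cyl m (w @ [j])))"
      by (intro blinfun_eqI) (simp add: blinfun.sum_left)
    then have "sqrt_at m E w o\<^sub>L Y w o\<^sub>L sqrt_at m E w
        = (\<Sum>j<m. sqrt_at m E (w @ [j]) o\<^sub>L Y (w @ [j]) o\<^sub>L sqrt_at m E (w @ [j]))"
      using Y by simp
    then show "sqrt_at m E w o\<^sub>L Y w o\<^sub>L sqrt_at m E w = sqrt_at m E w o\<^sub>L ?S o\<^sub>L sqrt_at m E w"
      by (simp only: compression_martingale_sum[OF E])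
  qed
  have "X \<in> dominated_martingales m c E"
    unfolding dominated_martingales_iff
  proof (intro conjI ballI)
    show "X \<in> (\<Pi>\<^sub>E w\<in>words m. ops_between (range_space m E w) (range_space m E w))"
      using Y by (auto simp: X_def)
    show "bdd_above ((\<lambda>w. norm (X w)) ` words m)"
      using Y X by (intro bdd_aboveI[of _ c]) auto
    show "X w = (\<Sum>j<m. cadjoint (edge_contraction m E w j) o\<^sub>L X (w @ [j]) o\<^sub>L edge_contraction m E w j)"
      if w: "w \<in> words m" for w
    proof -
      have "X (w @ [j]) = Y (w @ [j])" if "j < m" for j using w that by (intro X) auto
      then show ?thesis using mart[OF w] X[OF w] by (auto intro!: sum.cong)
    qed
  qed (use Y X in auto)
  moreover have "F (cyl m w) = sqrt_at m E w o\<^sub>L X w o\<^sub>L sqrt_at m E w" if "w \<in> words m" for w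
    using Y[of w] X[OF that] by simp
  ultimately show ?thesis by blast
qed

lemma dominated_measure_of_martingale:
  fixes E :: "'a::chilbert_space op_measure"
  assumes E: "E \<in> pos_op_measures m" and c: "0 \<le> c" and X: "X \<in> dominated_martingales m c E"
  shows "\<exists>F\<in>dominated_measures m c E.
    \<forall>w\<in>words m. F (cyl m w) = sqrt_at m E w o\<^sub>L X w o\<^sub>L sqrt_at m E w"
proof (rule dominated_measure_extension[OF E c])
  note X' = X[unfolded dominated_martingales_iff]
  have quad: "inner x ((sqrt_at m E w o\<^sub>L X w o\<^sub>L sqrt_at m E w) y)
      = inner (sqrt_at m E w x) (X w (sqrt_at m E w y))" for w x y
    by (simp add: inner_sqrt_at[OF E])
  have ran: "sqrt_at m E w x \<in> range_space m E w" for w x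
    unfolding range_space_def using closure_subset[of "range (sqrt_at m E w)"] by blast
  fix w assume w: "w \<in> words m"
  have XM: "X \<in> (\<Pi>\<^sub>E w\<in>words m. ops_between (range_space m E w) (range_space m E w))"
    and "symmetric_op (X w)"
    and mart: "X w =
      (\<Sum>j<m. cadjoint (edge_contraction m E w j) o\<^sub>L X (w @ [j]) o\<^sub>L edge_contraction m E w j)"
    and le: "\<And>x. x \<in> range_space m E w \<Longrightarrow> 0 \<le> inner x (X w x) \<and> inner x (X w x) \<le> c * inner x x"
    using X' w by blast+
  then have sym: "inner (X w x) y = inner x (X w y)" for x y by (simp add: symmetric_op_def)
  have "X w \<in> bounded_ops" using PiE_mem[OF XM w] by (simp add: ops_between_def)
  moreover have "symmetric_op (sqrt_at m E w o\<^sub>L X w o\<^sub>L sqrt_at m E w)"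
    unfolding symmetric_op_def quad by (simp add: sym flip: inner_sqrt_at[OF E])
  moreover have "0 \<le> inner x ((sqrt_at m E w o\<^sub>L X w o\<^sub>L sqrt_at m E w) x)" for x
    unfolding quad using le ran by blast
  ultimately show "sqrt_at m E w o\<^sub>L X w o\<^sub>L sqrt_at m E w \<in> positive_ops"
    using sqrt_at_bounded_op[OF E] by (simp add: positive_ops_iff psd_op_def bounded_ops_compose)
  show "inner x ((sqrt_at m E w o\<^sub>L X w o\<^sub>L sqrt_at m E w) x) \<le> c * inner x (E (cyl m w) x)" for x
    unfolding quad norm_sqrt_at[OF E, symmetric] power2_norm_eq_inner using le ran by blast
  show "sqrt_at m E w o\<^sub>L X w o\<^sub>L sqrt_at m E w
      = (\<Sum>j<m. sqrt_at m E (w @ [j]) o\<^sub>L X (w @ [j]) o\<^sub>L sqrt_at m E (w @ [j]))"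
    by (subst mart) (rule compression_martingale_sum[OF E])
qed

lemma dominated_martingales_eqI:
  assumes E: "E \<in> pos_op_measures m" and c: "0 \<le> c"
    and X: "X \<in> dominated_martingales m c E" and Y: "Y \<in> dominated_martingales m c E"
    and eq: "\<And>w. w \<in> words m \<Longrightarrow>
      sqrt_at m E w o\<^sub>L X w o\<^sub>L sqrt_at m E w = sqrt_at m E w o\<^sub>L Y w o\<^sub>L sqrt_at m E w"
  shows "X = Y"
proof (rule PiE_ext)
  show XP: "X \<in> (\<Pi>\<^sub>E w\<in>words m. ops_between (range_space m E w) (range_space m E w))"
    and YP: "Y \<in> (\<Pi>\<^sub>E w\<in>words m. ops_between (range_space m E w) (range_space m E w))"
    using X Y by (auto simp: dominated_martingales_iff)
  show "X w = Y w" if "w \<in> words m" for w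
    using PiE_mem[OF XP that] PiE_mem[OF YP that]
    by (intro compression_inj[OF sqrt_at_positive[OF E] _ _ eq[OF that]]) (auto simp: range_space_def)
qed

theorem corollary5p3:
  fixes m :: nat and c :: real and E :: "'a::chilbert_space op_measure"
  assumes "m \<ge> 2" and "c > 0" and "povm m E"
  shows "\<exists>\<Phi>. bij_betw \<Phi> (dominated_measures m c E) (dominated_martingales m c E) \<and>
    (\<forall>F \<in> dominated_measures m c E. \<forall>X \<in> dominated_martingales m c E.
       \<Phi> F = X \<longleftrightarrow>
         (\<forall>w \<in> words m. F (cyl m w) = sqrt_at m E w o\<^sub>L X w o\<^sub>L sqrt_at m E w)) \<and>
    (\<forall>F \<in> dominated_measures m c E. \<Phi> F [] = F (space (Omega m))) \<and>
    (\<forall>A \<in> positive_ops.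
       bij_betw \<Phi>
         {F \<in> dominated_measures m c E. F (space (Omega m)) = A}
         {X \<in> dominated_martingales m c E. X [] = A})"
proof -
  have E: "E \<in> pos_op_measures m" and E1: "E (space (Omega m)) = id_blinfun" and c: "0 \<le> c"
    using assms by (auto simp: povm_def)
  let ?P = "\<lambda>F X. \<forall>w \<in> words m. F (cyl m w) = sqrt_at m E w o\<^sub>L X w o\<^sub>L sqrt_at m E w"
  let ?D = "dominated_measures m c E" and ?M = "dominated_martingales m c E"
  have "\<exists>X\<in>?M. ?P F X" if "F \<in> ?D" for F by (rule martingale_of_dominated_measure[OF E c that])
  then obtain \<Phi> where \<Phi>: "\<And>F. F \<in> ?D \<Longrightarrow> \<Phi> F \<in> ?M" "\<And>F. F \<in> ?D \<Longrightarrow> ?P F (\<Phi> F)"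
    by metis
  have char: "\<Phi> F = X \<longleftrightarrow> ?P F X" if "F \<in> ?D" "X \<in> ?M" for F X
    using \<Phi>[OF that(1)] dominated_martingales_eqI[OF E c _ that(2), of "\<Phi> F"] by metis
  have bij: "bij_betw \<Phi> ?D ?M"
  proof (rule bij_betwI')
    show "\<Phi> F = \<Phi> G \<longleftrightarrow> F = G" if "F \<in> ?D" "G \<in> ?D" for F G
    proof
      assume eq: "\<Phi> F = \<Phi> G"
      show "F = G"
      proof (rule pos_op_measures_eqI)
        show "F \<in> pos_op_measures m" "G \<in> pos_op_measures m"
          using that by (auto simp: dominated_measures_def)
        show "F (cyl m w) = G (cyl m w)" if "w \<in> words m" for w
          using \<Phi>(2)[OF \<open>F \<in> ?D\<close>] \<Phi>(2)[OF \<open>G \<in> ?D\<close>] that by (simp add: eq)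
      qed
    qed simp
    show "\<exists>F\<in>?D. X = \<Phi> F" if "X \<in> ?M" for X
      using dominated_measure_of_martingale[OF E c that] char that by metis
  qed (rule \<Phi>(1))
  have total: "\<Phi> F [] = F (space (Omega m))" if "F \<in> ?D" for F
  proof -
    have "sqrt_at m E [] = id_blinfun" by (simp add: sqrt_at_def E1)
    moreover have "F (cyl m []) = sqrt_at m E [] o\<^sub>L \<Phi> F [] o\<^sub>L sqrt_at m E []"
      using \<Phi>(2)[OF that] by blast
    ultimately show ?thesis by (auto intro!: blinfun_eqI)
  qed
  have "bij_betw \<Phi> {F \<in> ?D. F (space (Omega m)) = A} {X \<in> ?M. X [] = A}" for A
  proof -
    have "\<Phi> ` {F \<in> ?D. F (space (Omega m)) = A} = {X \<in> ?M. X [] = A}"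
      using total bij_betw_imp_surj_on[OF bij] by (fastforce simp: image_iff set_eq_iff)
    then show ?thesis by (intro bij_betw_subset[OF bij]) auto
  qed
  then show ?thesis using bij char total by (intro exI[of _ \<Phi>]) blast
qed

end
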